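(* Assume that the class of all Erdős cardinals is proper. Then every poset-indexed diagram of $(\vee,0)$-semilattices and $(\vee,0)$-homomorphisms can be lifted, with respect to the $\mathrm{Con_c}$ functor, by some diagram of monotone-indexed unary algebras; that is, for every poset $P$ and every $P$-indexed diagram $\overrightarrow{\mathbf{S}}$ of $(\vee,0)$-semilattices and $(\vee,0)$-homomorphisms there is a $P$-indexed diagram $\overrightarrow{\mathbf{B}}$ in $\mathbf{MAlg}_1$ with $\mathrm{Con_c}\,\overrightarrow{\mathbf{B}}\cong\overrightarrow{\mathbf{S}}$.
   Context: All posets are nonempty; a $P$-indexed diagram is a functor from $P$ viewed as a category, and $\cong$ denotes natural isomorphism of $P$-indexed diagrams. A $(\vee,0)$-semilattice is a join-semilattice with least element $0$; $(\vee,0)$-homomorphisms preserve $\vee$ and $0$. $\mathbf{MAlg}_1$ (unary monotone-indexed algebras): objects are all structures $\mathbf{A}$ (with nonempty universe $A$) on arbitrary languages $\mathrm{Lg}(\mathbf{A})$ consisting only of unary operation symbols (no relation or constant symbols). A morphism $\mathbf{A}\to\mathbf{B}$ exists only if $\mathrm{Lg}(\mathbf{A})\subseteq\mathrm{Lg}(\mathbf{B})$, and is then a map $\varphi\colon A\to B$ with $\varphi(f^{\mathbf{A}}(x))=f^{\mathbf{B}}(\varphi(x))$ for all $f\in\mathrm{Lg}(\mathbf{A})$ and $x\in A$. $\mathrm{Con_c}\,\mathbf{A}$ is the $(\vee,0)$-semilattice of compact (= finitely generated) congruences of $\mathbf{A}$. For a morphism $\varphi\colon\mathbf{A}\to\mathbf{B}$,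 $\mathrm{Con_c}\,\varphi$ sends a compact congruence $\alpha$ to the congruence of $\mathbf{B}$ generated by $\{(\varphi(x),\varphi(y))\mid(x,y)\in\alpha\}$. Erdős cardinals: the $\theta$-th Erdős cardinal is the least $\kappa$ (if it exists) satisfying the partition relation $\kappa\rightarrow(\theta)^{<\omega}_2$, i.e., for every map $f\colon[\kappa]^{<\omega}\to\{0,1\}$ on finite subsets of $\kappa$ there is $H\subseteq\kappa$ of order type $\theta$ such that $f$ is constant on the $n$-element subsets of $H$, for each $n<\omega$. The class of Erdős cardinals being proper means that for every cardinal $\theta$ there is such a $\kappa$. *)

theory Defs
  imports
    "HOL-Algebra.Lattice"
    "HOL-Library.Countable_Set"
    "HOL-Library.Ramsey"
    "HOL.Hull"
begin

unbundle cardinal_syntax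

text \<open>
  Set-theoretic universe.  Quantification over all sets is read relative to a type \<open>'u\<close> whose
  cardinality is an uncountable strong limit: a set is small if it has fewer elements than \<open>'u\<close>,
  and up to bijection the small sets are the small subsets of \<open>'u\<close>.  Replacement (regularity of
  the cardinality of \<open>'u\<close>) is not imposed, so a small family of small sets need not have a small
  union; smallness of a diagram is therefore stated for the union of all its carriers.
\<close>

definition small :: "'u itself \<Rightarrow> 'a set \<Rightarrow> bool" where
  "small _ X \<longleftrightarrow> |X| <o |UNIV :: 'u set|"

definition set_universe :: "'u itself \<Rightarrow> bool" where
  "set_universe U \<longleftrightarrow>
     uncountable (UNIV :: 'u set) \<and> (\<forall>X :: 'u set. small U X \<longrightarrow> small U (Pow X))"


text \<open>
  The partition relation \<open>\<kappa> \<rightarrow> (\<theta>)\<^bsup><\<omega>\<^esup>\<^sub>2\<close> for well-orders \<open>\<kappa>\<close> and \<open>\<theta>\<close>; the values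
  of the colouring on infinite sets are irrelevant.
\<close>

definition partition_rel :: "'a rel \<Rightarrow> 'b rel \<Rightarrow> bool" where
  "partition_rel \<kappa> \<theta> \<longleftrightarrow>
     (\<forall>f :: 'a set \<Rightarrow> bool. \<exists>H \<subseteq> Field \<kappa>.
        Restr \<kappa> H =o \<theta> \<and> (\<forall>n. \<exists>c. \<forall>X \<in> nsets H n. f X = c))"

definition is_erdos_cardinal :: "'b rel \<Rightarrow> 'a rel \<Rightarrow> bool" where
  "is_erdos_cardinal \<theta> \<kappa> \<longleftrightarrow>
     Card_order \<kappa> \<and> partition_rel \<kappa> \<theta> \<and>
     (\<forall>\<kappa>' :: 'a rel. Card_order \<kappa>' \<and> partition_rel \<kappa>' \<theta> \<longrightarrow> \<kappa> \<le>o \<kappa>')"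

definition erdos_cardinals_proper :: "'u itself \<Rightarrow> bool" where
  "erdos_cardinals_proper U \<longleftrightarrow>
     (\<forall>\<theta> :: 'u rel. Card_order \<theta> \<and> small U (Field \<theta>) \<longrightarrow>
        (\<exists>\<kappa> :: 'u rel. small U (Field \<kappa>) \<and> is_erdos_cardinal \<theta> \<kappa>))"


text \<open>
  Diagrams indexed by the poset \<open>(P, r)\<close> in a concrete category, given by its objects, its
  morphisms and the underlying sets of its objects.  Morphisms are represented by total functions
  and identified when they agree on the underlying set of the source.
\<close>

definition poset_diagram ::
  "('o \<Rightarrow> bool) \<Rightarrow> ('o \<Rightarrow> 'o \<Rightarrow> ('a \<Rightarrow> 'a) \<Rightarrow> bool) \<Rightarrow> ('o \<Rightarrow> 'a set) \<Rightarrow>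
   'p set \<Rightarrow> 'p rel \<Rightarrow> ('p \<Rightarrow> 'o) \<Rightarrow> ('p \<Rightarrow> 'p \<Rightarrow> 'a \<Rightarrow> 'a) \<Rightarrow> bool" where
  "poset_diagram ob mor und P r D d \<longleftrightarrow>
     (\<forall>p\<in>P. ob (D p)) \<and>
     (\<forall>(p, q)\<in>r. mor (D p) (D q) (d p q)) \<and>
     (\<forall>p\<in>P. \<forall>x\<in>und (D p). d p p x = x) \<and>
     (\<forall>p q t. (p, q) \<in> r \<and> (q, t) \<in> r \<longrightarrow> (\<forall>x\<in>und (D p). d q t (d p q x) = d p t x))"


locale join_semilattice_0 = upper_semilattice L + weak_partial_order_bottom L
  for L (structure)

definition join_0_hom :: "'a gorder \<Rightarrow> 'b gorder \<Rightarrow> ('a \<Rightarrow> 'b) \<Rightarrow> bool" where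
  "join_0_hom L M h \<longleftrightarrow>
     h \<in> carrier L \<rightarrow> carrier M \<and>
     (\<forall>x\<in>carrier L. \<forall>y\<in>carrier L. h (x \<squnion>\<^bsub>L\<^esub> y) = h x \<squnion>\<^bsub>M\<^esub> h y) \<and>
     h \<bottom>\<^bsub>L\<^esub> = \<bottom>\<^bsub>M\<^esub>"

definition join_0_iso :: "'a gorder \<Rightarrow> 'b gorder \<Rightarrow> ('a \<Rightarrow> 'b) \<Rightarrow> bool" where
  "join_0_iso L M h \<longleftrightarrow> join_0_hom L M h \<and> bij_betw h (carrier L) (carrier M)"

abbreviation semilattice_diagram ::
  "'p set \<Rightarrow> 'p rel \<Rightarrow> ('p \<Rightarrow> 'a gorder) \<Rightarrow> ('p \<Rightarrow> 'p \<Rightarrow> 'a \<Rightarrow> 'a) \<Rightarrow> bool" where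
  "semilattice_diagram \<equiv> poset_diagram join_semilattice_0 join_0_hom carrier"

definition naturally_isomorphic ::
  "'p set \<Rightarrow> 'p rel \<Rightarrow> ('p \<Rightarrow> 'a gorder) \<Rightarrow> ('p \<Rightarrow> 'p \<Rightarrow> 'a \<Rightarrow> 'a) \<Rightarrow>
   ('p \<Rightarrow> 'b gorder) \<Rightarrow> ('p \<Rightarrow> 'p \<Rightarrow> 'b \<Rightarrow> 'b) \<Rightarrow> bool" where
  "naturally_isomorphic P r S s T t \<longleftrightarrow>
     (\<exists>\<eta>. (\<forall>p\<in>P. join_0_iso (S p) (T p) (\<eta> p)) \<and>
          (\<forall>(p, q)\<in>r. \<forall>x\<in>carrier (S p). \<eta> q (s p q x) = t p q (\<eta> p x)))"


record ('a, 'f) unary_algebra = "'a partial_object" +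
  lang :: "'f set"
  interp :: "'f \<Rightarrow> 'a \<Rightarrow> 'a"

definition is_unary_algebra :: "('a, 'f) unary_algebra \<Rightarrow> bool" where
  "is_unary_algebra A \<longleftrightarrow>
     carrier A \<noteq> {} \<and> (\<forall>f\<in>lang A. interp A f \<in> carrier A \<rightarrow> carrier A)"

definition malg_hom ::
  "('a, 'f) unary_algebra \<Rightarrow> ('b, 'f) unary_algebra \<Rightarrow> ('a \<Rightarrow> 'b) \<Rightarrow> bool" where
  "malg_hom A B \<phi> \<longleftrightarrow>
     lang A \<subseteq> lang B \<and> \<phi> \<in> carrier A \<rightarrow> carrier B \<and>
     (\<forall>f\<in>lang A. \<forall>x\<in>carrier A. \<phi> (interp A f x) = interp B f (\<phi> x))"

abbreviation malg_diagram ::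
  "'p set \<Rightarrow> 'p rel \<Rightarrow> ('p \<Rightarrow> ('a, 'f) unary_algebra) \<Rightarrow> ('p \<Rightarrow> 'p \<Rightarrow> 'a \<Rightarrow> 'a) \<Rightarrow> bool" where
  "malg_diagram \<equiv> poset_diagram is_unary_algebra malg_hom carrier"


definition congruence :: "('a, 'f) unary_algebra \<Rightarrow> 'a rel \<Rightarrow> bool" where
  "congruence A \<alpha> \<longleftrightarrow>
     equiv (carrier A) \<alpha> \<and>
     (\<forall>f\<in>lang A. \<forall>(x, y)\<in>\<alpha>. (interp A f x, interp A f y) \<in> \<alpha>)"

definition Con_c :: "('a, 'f) unary_algebra \<Rightarrow> 'a rel gorder" where
  "Con_c A =
     \<lparr> carrier = {congruence A hull X | X. finite X \<and> X \<subseteq> carrier A \<times> carrier A},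
       eq = (=), le = (\<subseteq>) \<rparr>"

definition Con_c_map :: "('b, 'f) unary_algebra \<Rightarrow> ('a \<Rightarrow> 'b) \<Rightarrow> 'a rel \<Rightarrow> 'b rel" where
  "Con_c_map B \<phi> \<alpha> = congruence B hull {(\<phi> x, \<phi> y) | x y. (x, y) \<in> \<alpha>}"

end

theory Submission
  imports Defs
begin

text \<open>
  A semilattice is turned into a coloured graph in which every edge of colour \<open>c\<close> spans, for all
  \<open>a, b\<close> with \<open>c \<le> a \<or> b\<close>, a new path (page) with colours \<open>a, b, a, b\<close> between its ends, and so
  on for the new edges.  Collapsing the edges with colour in an ideal \<open>I\<close> collapses no other edge,
  because a page cut at an end edge with colour outside \<open>I\<close> extends any cut of the edge below it.
  As each colour occurs twice on a page, a page can be folded onto a single edge of either colour;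
  with these folds and the shifts of a root edge onto the edges with the same label as unary
  operations, the congruences are exactly the collapses of ideals.  The graph and its operations
  depend only on the set of labels used for the colours.  Labelling the colours at \<open>q\<close> by the
  pairs \<open>(p, a)\<close> with \<open>p \<le> q\<close> and \<open>a \<in> S p\<close> makes both increase with \<open>q\<close>, so the inclusions
  induce the required diagram; operations born at \<open>q\<close> need to act only above \<open>q\<close>.
\<close>

section \<open>Edges, vertices and unary operations\<close>

text \<open>
  The page over \<open>E\<close> with labels \<open>a, b\<close> is the path \<open>x - z\<^sub>1 - z\<^sub>2 - z\<^sub>3 - y\<close> from the source to the
  target of \<open>E\<close>.  Its edges \<open>Sub E a b k f\<close> are, in this order, \<open>k f = True False\<close>, \<open>False True\<close>,
  \<open>True True\<close>, \<open>False False\<close>, all oriented towards \<open>z\<^sub>2\<close>; \<open>k\<close> selects the label \<open>a\<close>, and \<open>f\<close> says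
  that the edge ends in \<open>z\<^sub>2\<close>.  A vertex is named after an edge with that target, and \<open>z\<^sub>2\<close>, the
  target of two edges, after \<open>Sub E a b True True\<close>.
\<close>

datatype 'c edge = Root 'c | Sub "'c edge" 'c 'c (kind: bool) (far: bool)

datatype 'c vertex = Base | Tip "'c edge"

fun label :: "'c edge \<Rightarrow> 'c" where
  "label (Root c) = c"
| "label (Sub E a b k f) = (if k then a else b)"

fun target :: "'c edge \<Rightarrow> 'c vertex" where
  "target (Root c) = Tip (Root c)"
| "target (Sub E a b k f) = (if f then Tip (Sub E a b True True) else Tip (Sub E a b k False))"

fun source :: "'c edge \<Rightarrow> 'c vertex" where
  "source (Root c) = Base"
| "source (Sub E a b k f) =
     (if f then target (Sub E a b (\<not> k) False) else if k then source E else target E)"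

datatype 'c operation = Shift "'c edge" | Fold "'c edge"

fun op_edge :: "'c operation \<Rightarrow> 'c edge" where
  "op_edge (Shift F) = F"
| "op_edge (Fold F) = F"

definition image_source :: "'c edge + 'c vertex \<Rightarrow> 'c vertex" where
  "image_source = case_sum source id"

definition image_target :: "'c edge + 'c vertex \<Rightarrow> 'c vertex" where
  "image_target = case_sum target id"

lemma image_ends [simp]:
  "image_source (Inl E) = source E" "image_source (Inr v) = v"
  "image_target (Inl E) = target E" "image_target (Inr v) = v"
  by (simp_all add: image_source_def image_target_def)

text \<open>Contracting an edge contracts every page over it to the same vertex.\<close>

fun sub_image :: "'c edge + 'c vertex \<Rightarrow> 'c \<Rightarrow> 'c \<Rightarrow> bool \<Rightarrow> bool \<Rightarrow> 'c edge + 'c vertex" where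
  "sub_image (Inl E) a b k f = Inl (Sub E a b k f)"
| "sub_image (Inr v) a b k f = Inr v"

fun same_page :: "'c edge \<Rightarrow> 'c edge \<Rightarrow> bool" where
  "same_page (Sub E a b k f) (Sub E' a' b' k' f') \<longleftrightarrow> E = E' \<and> a = a' \<and> b = b'"
| "same_page _ _ \<longleftrightarrow> False"

text \<open>
  \<open>Shift F\<close> copies everything over the root edge labelled like \<open>F\<close> to \<open>F\<close> and sends the rest to
  the source of \<open>F\<close>.  \<open>Fold F\<close> folds the page containing \<open>F\<close> onto the root edge labelled like \<open>F\<close>
  and sends the rest to \<open>Base\<close>.  The right summand stands for an edge contracted to a vertex.
\<close>

fun edge_map :: "'c operation \<Rightarrow> 'c edge \<Rightarrow> 'c edge + 'c vertex" where
  "edge_map (Shift F) (Root c) = (if c = label F then Inl F else Inr (source F))"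
| "edge_map (Fold F) (Root c) = Inr Base"
| "edge_map (Shift F) (Sub E a b k f) = sub_image (edge_map (Shift F) E) a b k f"
| "edge_map (Fold F) (Sub E a b k f) =
     (if same_page F (Sub E a b k f)
      then if k = kind F then Inl (Root (label F))
           else Inr (if f then Tip (Root (label F)) else Base)
      else sub_image (edge_map (Fold F) E) a b k f)"

fun vertex_map :: "'c operation \<Rightarrow> 'c vertex \<Rightarrow> 'c vertex" where
  "vertex_map (Shift F) Base = source F"
| "vertex_map (Fold F) Base = Base"
| "vertex_map g (Tip E) = image_target (edge_map g E)"

text \<open>The edges below \<open>G\<close> are smaller than \<open>F\<close>, hence off its page
  too, since the four edges of a page have equal size. The recursion therefore ends in a root, which
  a fold sends to \<open>Base\<close>.\<close>

lemma edge_map_Fold_outside: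
  "size G \<le> size F \<Longrightarrow> \<not> same_page F G \<Longrightarrow> edge_map (Fold F) G = Inr Base"
proof (induction G)
  case (Sub E a b k f)
  have "\<not> same_page F E"
    using Sub.prems(1) by (cases F; cases E) auto
  with Sub show ?case
    by auto
qed simp

lemma same_pageE:
  assumes "same_page F (Sub E a b k f)"
  obtains k' f' where "F = Sub E a b k' f'"
  using assms by (cases F) auto

text \<open>The edge carrying the page of \<open>F\<close> is smaller than \<open>F\<close>. So both
  ends of the page go to \<open>Base\<close>, which is what allows the page to be folded onto a root
  edge.\<close>

lemma edge_map_Fold_parent:
  assumes "same_page F (Sub E a b k f)"
  shows "edge_map (Fold F) E = Inr Base"
proof -
  obtain k' f' where F: "F = Sub E a b k' f'"
    using assms by (rule same_pageE)
  show ?thesis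
    by (rule edge_map_Fold_outside) (cases E; simp add: F)+
qed

text \<open>Two edges end in \<open>z\<^sub>2\<close>, so its image must not depend on the edge it
  is named after. With the next lemma, every operation is a graph map that may contract
  edges.\<close>

lemma vertex_map_target: "vertex_map g (target E) = image_target (edge_map g E)"
proof (cases E)
  case (Sub E' a b k f)
  show ?thesis
  proof (cases g)
    case (Shift F)
    then show ?thesis
      using Sub by (cases "edge_map (Shift F) E'") auto
  next
    case (Fold F)
    then show ?thesis
      using Sub by (cases F; cases "edge_map (Fold F) E'") auto
  qed
qed simp

text \<open>The source of a page edge is an end of the edge below or the target of a sibling, so
  targets and the induction hypothesis suffice.\<close>

lemma vertex_map_source: "vertex_map g (source E) = image_source (edge_map g E)"
proof (induction E)
  case (Root c)
  then show ?case by (cases g) auto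
next
  case (Sub E a b k f)
  show ?case
  proof (cases g)
    case (Shift F)
    then show ?thesis
      using Sub vertex_map_target[of g E] vertex_map_target[of g "Sub E a b (\<not> k) False"]
      by (cases "edge_map (Shift F) E") auto
  next
    case (Fold F)
    show ?thesis
    proof (cases "same_page F (Sub E a b k f)")
      case True
      then have "edge_map (Fold F) E = Inr Base"
        by (rule edge_map_Fold_parent)
      moreover obtain k' f' where "F = Sub E a b k' f'"
        using True by (rule same_pageE)
      ultimately show ?thesis
        using Sub vertex_map_target[of g E] vertex_map_target[of g "Sub E a b (\<not> k) False"] Fold
        by auto
    next
      case False
      moreover from False have "\<not> same_page F (Sub E a b (\<not> k) False)"
        by (cases F) auto
      ultimately show ?thesis
        using Sub vertex_map_target[of g E] vertex_map_target[of g "Sub E a b (\<not> k) False"] Fold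
        by (cases "edge_map (Fold F) E") auto
    qed
  qed
qed

text \<open>Induction measure: the inner vertices of a page outrank both ends of the edge that
  carries it.\<close>

fun rank :: "'c vertex \<Rightarrow> nat" where
  "rank Base = 0"
| "rank (Tip E) = Suc (size E)"


section \<open>The coloured graph over a semilattice\<close>

locale semilattice_colouring = join_semilattice_0 L
  for L :: "'a gorder" (structure) +
  fixes C :: "'c set" and col :: "'c \<Rightarrow> 'a"
  assumes col_image: "col ` C = carrier L"
begin

lemma col_closed [simp]: "c \<in> C \<Longrightarrow> col c \<in> carrier L"
  using col_image by blast

definition ideal :: "'a set \<Rightarrow> bool" where
  "ideal I \<longleftrightarrow> I \<subseteq> carrier L \<and> \<bottom> \<in> I \<and>
     (\<forall>a\<in>I. \<forall>b\<in>I. \<forall>c\<in>carrier L. c \<sqsubseteq> a \<squnion> b \<longrightarrow> c \<in> I)"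

definition down :: "'a \<Rightarrow> 'a set" where
  "down a = {x \<in> carrier L. x \<sqsubseteq> a}"

lemma ideal_down: "a \<in> carrier L \<Longrightarrow> ideal (down a)"
  unfolding ideal_def down_def
  using join_le by (auto dest: le_trans[of _ "_ \<squnion> _" a])

lemma down_mono: "a \<sqsubseteq> b \<Longrightarrow> a \<in> carrier L \<Longrightarrow> b \<in> carrier L \<Longrightarrow> down a \<subseteq> down b"
  by (auto simp: down_def intro: le_trans)

lemma ideal_down_subset:
  assumes "ideal I" "a \<in> I" shows "down a \<subseteq> I"
proof
  fix x assume "x \<in> down a"
  moreover have "a \<in> carrier L"
    using assms by (auto simp: ideal_def)
  \<comment> \<open>Downward closure is the case of equal arguments in the join condition of
    \<open>ideal\<close>.\<close>
  ultimately have "x \<in> carrier L" "x \<sqsubseteq> a \<squnion> a"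
    using join_left[of a a] le_trans[of x a "a \<squnion> a"] by (auto simp: down_def)
  with assms show "x \<in> I"
    unfolding ideal_def by blast
qed

inductive_set edges :: "'c edge set" where
  Root: "c \<in> C \<Longrightarrow> Root c \<in> edges"
| Sub: "E \<in> edges \<Longrightarrow> a \<in> C \<Longrightarrow> b \<in> C \<Longrightarrow> col (label E) \<sqsubseteq> col a \<squnion> col b \<Longrightarrow>
    Sub E a b k f \<in> edges"

inductive_cases edges_RootE: "Root c \<in> edges"
inductive_cases edges_SubE: "Sub E a b k f \<in> edges"

lemma edges_siblings: "Sub E a b k f \<in> edges \<Longrightarrow> Sub E a b k' f' \<in> edges"
  by (auto elim!: edges_SubE intro: edges.Sub)

lemma label_closed [simp]: "E \<in> edges \<Longrightarrow> label E \<in> C"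
  by (induction rule: edges.induct) auto

definition vertices :: "'c vertex set" where
  "vertices = insert Base (target ` edges)"

lemma target_vertices [intro, simp]: "E \<in> edges \<Longrightarrow> target E \<in> vertices"
  by (simp add: vertices_def)

lemma source_vertices [intro, simp]: "E \<in> edges \<Longrightarrow> source E \<in> vertices"
proof (induction rule: edges.induct)
  case (Sub E a b k f)
  then have "target (Sub E a b (\<not> k) False) \<in> vertices"
    by (blast intro: edges.Sub)
  with Sub show ?case by auto
qed (simp add: vertices_def)

lemma Base_vertices [simp]: "Base \<in> vertices"
  by (simp add: vertices_def)

text \<open>The edge after which a target is named lies on the same page, and a page belongs to the
  graph as a whole.\<close>

lemma Tip_edges:
  assumes "Tip E \<in> vertices" shows "E \<in> edges"
proof -
  obtain F where F: "F \<in> edges" "Tip E = target F"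
    using assms by (auto simp: vertices_def)
  show ?thesis
    by (cases F) (use F in \<open>auto split: if_splits intro: edges_siblings\<close>)
qed

lemma Tip_normal:
  assumes "Tip (Sub E a b k f) \<in> vertices" "f" shows "k"
proof -
  obtain F where "Tip (Sub E a b k f) = target F"
    using assms(1) by (auto simp: vertices_def)
  with assms(2) show ?thesis
    by (cases F) (auto split: if_splits)
qed

definition operations :: "'c operation set" where
  "operations = {g. op_edge g \<in> edges}"

text \<open>Keeping the label is what makes the equivalences \<open>\<theta> I\<close> below
  invariant under the operations.\<close>

definition image_ok :: "'c edge \<Rightarrow> 'c edge + 'c vertex \<Rightarrow> bool" where
  "image_ok E m \<longleftrightarrow> (case m of Inl E' \<Rightarrow> E' \<in> edges \<and> label E' = label E | Inr v \<Rightarrow> v \<in> vertices)"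

lemma image_ok_sub:
  assumes "image_ok E m" "Sub E a b k f \<in> edges"
  shows "image_ok (Sub E a b k f) (sub_image m a b k f)"
  using assms by (cases m) (auto simp: image_ok_def elim!: edges_SubE intro: edges.Sub)

lemma Tip_Root_vertices: "c \<in> C \<Longrightarrow> Tip (Root c) \<in> vertices"
  using target_vertices[OF edges.Root] by simp

lemma edge_map_ok:
  assumes "g \<in> operations" "E \<in> edges"
  shows "image_ok E (edge_map g E)"
  using assms(2)
proof (induction rule: edges.induct)
  case (Root c)
  then show ?case
    using assms(1) by (cases g) (auto simp: image_ok_def operations_def)
next
  case (Sub E a b k f)
  have edge: "Sub E a b k f \<in> edges"
    using Sub by (auto intro: edges.Sub)
  show ?case
  proof (cases g)
    case (Shift F)
    then show ?thesis using image_ok_sub[OF Sub.IH edge] by simp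
  next
    case (Fold F)
    then have "F \<in> edges" using assms(1) by (simp add: operations_def)
    then have "label F \<in> C" by simp
    moreover have "label F = (if kind F then a else b)" if "same_page F (Sub E a b k f)"
      using that by (cases F) auto
    ultimately show ?thesis
      using image_ok_sub[OF Sub.IH edge] Fold
      by (auto simp: image_ok_def edges.Root Tip_Root_vertices)
  qed
qed

lemma vertex_map_closed:
  assumes "g \<in> operations" "v \<in> vertices"
  shows "vertex_map g v \<in> vertices"
proof (cases v)
  case Base
  then show ?thesis using assms(1) by (cases g) (auto simp: operations_def)
next
  case (Tip E)
  then have "image_ok E (edge_map g E)"
    using edge_map_ok assms Tip_edges by blast
  then show ?thesis
    using Tip by (cases "edge_map g E") (auto simp: image_ok_def)
qed


subsection \<open>The equivalences generated by the edges with colour in an ideal\<close>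

definition collapsed :: "'a set \<Rightarrow> ('c vertex \<times> 'c vertex) set" where
  "collapsed I = {(source E, target E) | E. E \<in> edges \<and> col (label E) \<in> I}"

text \<open>The closure is reflexive on the whole type, so it is restricted to the vertices of the
  graph.\<close>

definition \<theta> :: "'a set \<Rightarrow> 'c vertex rel" where
  "\<theta> I = (collapsed I \<union> (collapsed I)\<inverse>)\<^sup>* \<inter> vertices \<times> vertices"

lemma equiv_theta: "equiv vertices (\<theta> I)"
proof (rule equivI)
  have "sym ((collapsed I \<union> (collapsed I)\<inverse>)\<^sup>*)"
    by (rule sym_rtrancl) (auto simp: sym_def)
  then show "sym (\<theta> I)"
    by (auto simp: \<theta>_def sym_def)
  show "trans (\<theta> I)"
    by (auto simp: \<theta>_def trans_def)
qed (auto simp: \<theta>_def refl_on_def)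

lemma theta_edge: "E \<in> edges \<Longrightarrow> col (label E) \<in> I \<Longrightarrow> (source E, target E) \<in> \<theta> I"
  by (auto simp: \<theta>_def collapsed_def)

lemma theta_refl: "v \<in> vertices \<Longrightarrow> (v, v) \<in> \<theta> I"
  by (simp add: \<theta>_def)

lemma theta_sym: "(u, v) \<in> \<theta> I \<Longrightarrow> (v, u) \<in> \<theta> I"
  using equiv_theta by (meson equivE symD)

lemma theta_trans: "(u, v) \<in> \<theta> I \<Longrightarrow> (v, w) \<in> \<theta> I \<Longrightarrow> (u, w) \<in> \<theta> I"
  using equiv_theta by (meson equivE transD)

lemma theta_vertices: "(u, v) \<in> \<theta> I \<Longrightarrow> u \<in> vertices \<and> v \<in> vertices"
  by (simp add: \<theta>_def)

text \<open>Lets properties of \<open>\<theta> I\<close> be checked on single collapsed edges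
  instead of along paths.\<close>

lemma theta_induct [consumes 1, case_names refl edge sym trans]:
  assumes "(u, v) \<in> \<theta> I"
    and refl: "\<And>v. v \<in> vertices \<Longrightarrow> R v v"
    and edge: "\<And>E. E \<in> edges \<Longrightarrow> col (label E) \<in> I \<Longrightarrow> R (source E) (target E)"
    and sym: "\<And>u v. R u v \<Longrightarrow> R v u"
    and trans: "\<And>u v w. R u v \<Longrightarrow> R v w \<Longrightarrow> R u w"
  shows "R u v"
proof -
  have "(u, v) \<in> (collapsed I \<union> (collapsed I)\<inverse>)\<^sup>*" and u: "u \<in> vertices"
    using assms(1) by (auto simp: \<theta>_def)
  from this(1) show ?thesis
  proof (induction rule: rtrancl_induct)
    case base
    then show ?case using refl u by blast
  next
    case (step v w)
    then have "R v w"
      by (auto simp: collapsed_def intro: edge sym)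
    with step show ?case by (blast intro: trans)
  qed
qed

lemma theta_mono: "I \<subseteq> J \<Longrightarrow> \<theta> I \<subseteq> \<theta> J"
proof
  fix p assume "I \<subseteq> J" "p \<in> \<theta> I"
  moreover obtain u v where "p = (u, v)" by force
  ultimately have "(u, v) \<in> \<theta> I" "I \<subseteq> J" by auto
  then have "(u, v) \<in> \<theta> J"
    by (induction rule: theta_induct) (auto intro: theta_refl theta_edge theta_sym theta_trans)
  then show "p \<in> \<theta> J" using \<open>p = (u, v)\<close> by simp
qed

text \<open>A collapsed edge goes to an edge with the same label, which is collapsed too, or to a
  single vertex.\<close>

lemma theta_vertex_map:
  assumes "(u, v) \<in> \<theta> I" "g \<in> operations"
  shows "(vertex_map g u, vertex_map g v) \<in> \<theta> I"
  using assms(1)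
proof (induction rule: theta_induct)
  case (refl v)
  then show ?case using assms(2) by (auto intro: theta_refl vertex_map_closed)
next
  case (edge E)
  then have "image_ok E (edge_map g E)"
    using edge_map_ok assms(2) by blast
  then show ?case
    unfolding vertex_map_source vertex_map_target using edge
    by (cases "edge_map g E") (auto simp: image_ok_def intro: theta_refl dest: theta_edge)
qed (auto intro: theta_sym theta_trans)

text \<open>
  A cut of the graph along the root edge labelled \<open>c\<close>: if the ends of an edge lie on different
  sides, then the page over it is cut at an end edge whose colour is outside \<open>I\<close>.
\<close>

primrec cut :: "'a set \<Rightarrow> 'c \<Rightarrow> 'c edge \<Rightarrow> bool \<times> bool" where
  "cut I c (Root d) = (False, d = c)"
| "cut I c (Sub E a b k f) =
     (let x = fst (cut I c E); y = snd (cut I c E); z = (if col a \<in> I then x else y)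
      in if f then (z, z) else (if k then x else y, z))"

fun side :: "'a set \<Rightarrow> 'c \<Rightarrow> 'c vertex \<Rightarrow> bool" where
  "side I c Base = False"
| "side I c (Tip E) = snd (cut I c E)"

lemma side_target: "side I c (target E) = snd (cut I c E)"
  by (cases E) (auto simp: Let_def)

lemma side_source: "side I c (source E) = fst (cut I c E)"
  by (induction E) (auto simp: Let_def side_target)

text \<open>If the edge below is cut, only an end edge of the page is: the one labelled
  \<open>a\<close> when \<open>col a\<close> is outside \<open>I\<close>, otherwise the one labelled
  \<open>b\<close>. In the latter case \<open>col b\<close> in \<open>I\<close> would put the colour
  below into \<open>I\<close> as well, and that edge would be uncut by induction.\<close>

lemma cut_uncut:
  assumes "ideal I" "col c \<notin> I" "E \<in> edges" "col (label E) \<in> I"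
  shows "fst (cut I c E) = snd (cut I c E)"
  using assms(3,4)
proof (induction rule: edges.induct)
  case (Root d)
  then show ?case using assms by auto
next
  case (Sub E a b k f)
  have "fst (cut I c E) = snd (cut I c E)" if "col a \<in> I" "col b \<in> I"
  proof -
    have "col (label E) \<in> I"
      using that Sub.hyps assms(1) unfolding ideal_def by (meson col_closed label_closed)
    then show ?thesis by (rule Sub.IH)
  qed
  then show ?case
    using Sub.prems by (auto simp: Let_def)
qed

text \<open>If \<open>col c\<close> is outside \<open>I\<close>, then \<open>side\<close> is
  constant on the classes but separates \<open>Base\<close> from \<open>Tip (Root c)\<close>. Hence
  an ideal can be recovered from its collapse.\<close>

lemma theta_Root_iff:
  assumes "ideal I" "c \<in> C"
  shows "(Base, Tip (Root c)) \<in> \<theta> I \<longleftrightarrow> col c \<in> I"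
proof
  assume "col c \<in> I"
  then show "(Base, Tip (Root c)) \<in> \<theta> I"
    using theta_edge[OF edges.Root[OF assms(2)]] by simp
next
  assume in_theta: "(Base, Tip (Root c)) \<in> \<theta> I"
  show "col c \<in> I"
  proof (rule ccontr)
    assume "col c \<notin> I"
    from in_theta have "side I c Base = side I c (Tip (Root c))"
      by (induction rule: theta_induct)
        (auto simp: side_source side_target cut_uncut[OF assms(1) \<open>col c \<notin> I\<close>])
    then show False by simp
  qed
qed

end


section \<open>Equivalences invariant under all operations are collapses of ideals\<close>

lemma rank_target [simp]: "rank (target E) = Suc (size E)"
  by (cases E) auto

lemma edge_size_pos: "0 < size (E :: 'c edge)"
  by (cases E) auto

lemma rank_source: "rank (source E) \<le> Suc (size E)"
  by (induction E) auto

lemma vertex_map_Fold_page: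
  "vertex_map (Fold (Sub E a b k f)) (Tip (Sub E a b k' f')) =
     (if k' = k \<or> f' then Tip (Root (if k then a else b)) else Base)"
  by auto

lemma vertex_map_Fold_outside:
  assumes "rank v \<le> Suc (size F)" "\<And>G. v = Tip G \<Longrightarrow> \<not> same_page F G"
  shows "vertex_map (Fold F) v = Base"
  using assms by (cases v) (auto simp: edge_map_Fold_outside)

context semilattice_colouring
begin

text \<open>By \<open>theta_Root_iff\<close> this is the only ideal whose collapse can be
  \<open>\<Theta>\<close>.\<close>

definition root_colours :: "'c vertex rel \<Rightarrow> 'a set" where
  "root_colours \<Theta> = {col c | c. c \<in> C \<and> (Base, Tip (Root c)) \<in> \<Theta>}"

text \<open>These are the properties of a congruence pulled back to the vertices. The algebra will
  identify vertices related by \<open>\<theta> {\<bottom>}\<close>, whence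
  \<open>bot_subset\<close>.\<close>

context
  fixes \<Theta> :: "'c vertex rel"
  assumes equiv: "equiv vertices \<Theta>"
    and bot_subset: "\<theta> {\<bottom>} \<subseteq> \<Theta>"
    and invariant: "\<And>g u v. g \<in> operations \<Longrightarrow> (u, v) \<in> \<Theta> \<Longrightarrow> (vertex_map g u, vertex_map g v) \<in> \<Theta>"
begin

lemma invariant_sym: "(u, v) \<in> \<Theta> \<Longrightarrow> (v, u) \<in> \<Theta>"
  using equiv by (meson equivE symD)

lemma invariant_trans: "(u, v) \<in> \<Theta> \<Longrightarrow> (v, w) \<in> \<Theta> \<Longrightarrow> (u, w) \<in> \<Theta>"
  using equiv by (meson equivE transD)

lemma invariant_refl: "v \<in> vertices \<Longrightarrow> (v, v) \<in> \<Theta>"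
  using equiv by (meson equivE refl_onD)

lemma invariant_vertices: "(u, v) \<in> \<Theta> \<Longrightarrow> u \<in> vertices \<and> v \<in> vertices"
  using equiv by (auto simp: equiv_def)

text \<open>\<open>Shift E\<close> carries the root edge labelled like \<open>E\<close> to
  \<open>E\<close>.\<close>

lemma invariant_edge:
  assumes "E \<in> edges" "(Base, Tip (Root (label E))) \<in> \<Theta>"
  shows "(source E, target E) \<in> \<Theta>"
  using invariant[of "Shift E", OF _ assms(2)] assms(1) by (simp add: operations_def)

text \<open>All four edges of the page over \<open>Root c\<close> with labels \<open>a\<close>,
  \<open>b\<close> are collapsed, and they connect the ends of \<open>Root c\<close>.\<close>

lemma invariant_join:
  assumes "a \<in> C" "b \<in> C" "c \<in> C" "col c \<sqsubseteq> col a \<squnion> col b"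
    and "(Base, Tip (Root a)) \<in> \<Theta>" "(Base, Tip (Root b)) \<in> \<Theta>"
  shows "(Base, Tip (Root c)) \<in> \<Theta>"
proof -
  let ?E = "Sub (Root c) a b"
  have edge: "(source (?E k f), target (?E k f)) \<in> \<Theta>" for k f
    using assms by (intro invariant_edge edges.intros) auto
  have "(Base, Tip (?E True False)) \<in> \<Theta>" "(Tip (?E True False), Tip (?E True True)) \<in> \<Theta>"
    "(Tip (?E False False), Tip (?E True True)) \<in> \<Theta>" "(Tip (Root c), Tip (?E False False)) \<in> \<Theta>"
    using edge[of True False] edge[of False True] edge[of True True] edge[of False False]
    by simp_all
  then show ?thesis
    by (meson invariant_sym invariant_trans)
qed

text \<open>Whether a root edge is collapsed depends only on its colour: a label \<open>d\<close> of
  the same colour gives \<open>c\<close> through the join of \<open>col d\<close> with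
  itself.\<close>

lemma root_colours_iff:
  assumes "c \<in> C"
  shows "col c \<in> root_colours \<Theta> \<longleftrightarrow> (Base, Tip (Root c)) \<in> \<Theta>"
proof
  assume "col c \<in> root_colours \<Theta>"
  then obtain d where "d \<in> C" "(Base, Tip (Root d)) \<in> \<Theta>" "col c = col d"
    by (auto simp: root_colours_def)
  then show "(Base, Tip (Root c)) \<in> \<Theta>"
    using assms join_left[of "col d" "col d"] invariant_join[of d d c] by simp
qed (use assms in \<open>auto simp: root_colours_def\<close>)

lemma ideal_root_colours: "ideal (root_colours \<Theta>)"
  unfolding ideal_def
proof (intro conjI ballI impI)
  show "root_colours \<Theta> \<subseteq> carrier L"
    by (auto simp: root_colours_def)
  \<comment> \<open>Since \<open>col\<close> is onto, some root edge has the bottom colour, and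
    \<open>bot_subset\<close> collapses it.\<close>
  obtain c where c: "c \<in> C" "col c = \<bottom>"
    by (metis bottom_closed col_image imageE)
  then have "(Base, Tip (Root c)) \<in> \<theta> {\<bottom>}"
    using theta_edge[OF edges.Root] by fastforce
  then show "\<bottom> \<in> root_colours \<Theta>"
    using bot_subset root_colours_iff[OF c(1)] unfolding c(2) by blast
next
  fix x y z
  assume "x \<in> root_colours \<Theta>" "y \<in> root_colours \<Theta>" and z: "z \<in> carrier L" "z \<sqsubseteq> x \<squnion> y"
  then obtain a b where ab: "a \<in> C" "x = col a" "(Base, Tip (Root a)) \<in> \<Theta>"
    "b \<in> C" "y = col b" "(Base, Tip (Root b)) \<in> \<Theta>"
    by (auto simp: root_colours_def)
  obtain c where c: "c \<in> C" "z = col c"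
    using z(1) unfolding col_image[symmetric] by (rule imageE)
  then have "(Base, Tip (Root c)) \<in> \<Theta>"
    using invariant_join ab z(2) by simp
  then show "z \<in> root_colours \<Theta>"
    using root_colours_iff c by simp
qed

lemma theta_root_colours_subset: "\<theta> (root_colours \<Theta>) \<subseteq> \<Theta>"
proof -
  have "(u, v) \<in> \<Theta>" if "(u, v) \<in> \<theta> (root_colours \<Theta>)" for u v
    using that
  proof (induction rule: theta_induct)
    case (edge E)
    then show ?case
      using root_colours_iff invariant_edge by simp
  qed (auto intro: invariant_refl invariant_sym invariant_trans)
  then show ?thesis by auto
qed

text \<open>Applying the fold to the pair yields the two ends of the root edge labelled like
  \<open>F\<close>.\<close>

lemma fold_detects:
  assumes "(u, v) \<in> \<Theta>" "F \<in> edges"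
    and "vertex_map (Fold F) u = Tip (Root (label F))" "vertex_map (Fold F) v = Base"
  shows "col (label F) \<in> root_colours \<Theta>"
proof -
  have "(Base, Tip (Root (label F))) \<in> \<Theta>"
    using invariant[OF _ assms(1), of "Fold F"] assms by (auto simp: operations_def intro: invariant_sym)
  then show ?thesis
    using assms(2) by (simp add: root_colours_iff)
qed

text \<open>
  Induction on the total rank: the folds onto root edges either show that a vertex of maximal
  rank can be replaced by an end of the edge carrying its page, or join the two vertices inside
  a common page.
\<close>

lemma subset_theta_root_colours:
  "(u, v) \<in> \<Theta> \<Longrightarrow> (u, v) \<in> \<theta> (root_colours \<Theta>)"
proof (induction "rank u + rank v" arbitrary: u v rule: less_induct)
  case less
  let ?I = "root_colours \<Theta>"
  \<comment> \<open>The induction hypothesis is a premise here, so that the claim can be applied to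
    the pair in either order.\<close>
  have ordered: "(x, y) \<in> \<theta> ?I"
    if xy: "(x, y) \<in> \<Theta>" and le: "rank y \<le> rank x"
      and IH: "\<And>x' y'. rank x' + rank y' < rank x + rank y \<Longrightarrow> (x', y') \<in> \<Theta> \<Longrightarrow> (x', y') \<in> \<theta> ?I"
    for x y
  proof (cases x)
    case Base
    then have "y = x" using le by (cases y) auto
    then show ?thesis using invariant_vertices[OF xy] by (auto intro: theta_refl)
  next
    case (Tip F)
    then have F: "F \<in> edges"
      using invariant_vertices[OF xy] Tip_edges by blast
    show ?thesis
    proof (cases F)
      case (Root c)
      have root: "(Base, Tip (Root d)) \<in> \<theta> ?I" if "(Base, Tip (Root d)) \<in> \<Theta>" "Root d \<in> edges" for d
      proof -
        have "d \<in> C" using that(2) by (auto elim: edges_RootE)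
        then show ?thesis
          using that(1) theta_edge[OF that(2)] by (simp add: root_colours_iff)
      qed
      show ?thesis
      proof (cases y)
        case Base
        then show ?thesis
          using Tip Root xy F by (auto intro: theta_sym invariant_sym root)
      next
        case (Tip G)
        \<comment> \<open>The rank of \<open>y\<close> is at most that of a root tip, which excludes
          page edges.\<close>
        then obtain d where G: "G = Root d" "Root d \<in> edges"
          using le \<open>x = Tip F\<close> Root invariant_vertices[OF xy]
          by (cases G) (auto dest: Tip_edges simp: edge_size_pos[THEN less_imp_neq, symmetric])
        show ?thesis
        proof (cases "c = d")
          case True
          then show ?thesis
            using Root G Tip \<open>x = Tip F\<close> invariant_vertices[OF xy] by (auto intro: theta_refl)
        next
          case False
          \<comment> \<open>Shifting a root edge to itself fixes its tip and sends the tip of any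
            other root edge to \<open>Base\<close>.\<close>
          have "(Tip (Root c), Base) \<in> \<Theta>" "(Base, Tip (Root d)) \<in> \<Theta>"
            using invariant[of "Shift (Root c)", OF _ xy] invariant[of "Shift (Root d)", OF _ xy]
              False Root G Tip \<open>x = Tip F\<close> F by (auto simp: operations_def)
          then have "(Base, Tip (Root c)) \<in> \<theta> ?I" "(Base, Tip (Root d)) \<in> \<theta> ?I"
            using Root G F by (auto intro: root invariant_sym)
          then show ?thesis
            using Root G Tip \<open>x = Tip F\<close> by (blast intro: theta_sym theta_trans)
        qed
      qed
    next
      case (Sub E a b k f)
      let ?P = "Sub E a b"
      let ?lab = "\<lambda>k. if k then a else b"
      have edge: "?P k' f' \<in> edges" for k' f'
        using F Sub by (auto intro: edges_siblings)
      have in_theta: "(source (?P k' f'), target (?P k' f')) \<in> \<theta> ?I" if "col (?lab k') \<in> ?I" for k' f'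
        using that by (intro theta_edge edge) simp
      have detect: "col (?lab k') \<in> ?I"
        if "(w, z) \<in> \<Theta>" "vertex_map (Fold (?P k' False)) w = Tip (Root (?lab k'))"
          "vertex_map (Fold (?P k' False)) z = Base" for w z k'
        using fold_detects[OF that(1) edge[of k' False]] that(2,3) by simp
      have normal: "f \<Longrightarrow> k"
        using Tip Sub invariant_vertices[OF xy] by (auto intro: Tip_normal)
      show ?thesis
      proof (cases "\<exists>k' f'. y = Tip (?P k' f')")
        case True
        then obtain k' f' where y: "y = Tip (?P k' f')" by blast
        have normal': "f' \<Longrightarrow> k'"
          using y invariant_vertices[OF xy] by (auto intro: Tip_normal)
        \<comment> \<open>The edge joining the inner vertex of kind \<open>h\<close> to the middle
          has kind \<open>\<not> h\<close>, and the fold of that kind separates these two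
          vertices.\<close>
        have far_near: "(Tip (?P True True), Tip (?P h False)) \<in> \<theta> ?I"
          if "(Tip (?P True True), Tip (?P h False)) \<in> \<Theta>" for h
          using detect[OF that, of "\<not> h"] in_theta[of "\<not> h" True]
          by (auto simp: vertex_map_Fold_page simp del: vertex_map.simps intro: theta_sym)
        \<comment> \<open>Each of the two folds separates the outer inner vertices
          \<open>z\<^sub>1\<close> and \<open>z\<^sub>3\<close>, so both colours are in the ideal
          and the path through the middle is collapsed.\<close>
        have near_near: "(Tip (?P h False), Tip (?P (\<not> h) False)) \<in> \<theta> ?I"
          if *: "(Tip (?P h False), Tip (?P (\<not> h) False)) \<in> \<Theta>" for h
        proof -
          have "col (?lab h) \<in> ?I"
            by (rule detect[OF *]) (auto simp: vertex_map_Fold_page simp del: vertex_map.simps)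
          moreover have "col (?lab (\<not> h)) \<in> ?I"
            by (rule detect[OF invariant_sym[OF *]])
              (auto simp: vertex_map_Fold_page simp del: vertex_map.simps)
          ultimately show ?thesis
            using in_theta[of h True] in_theta[of "\<not> h" True] by (auto intro: theta_sym theta_trans)
        qed
        consider "f" "f'" | "f" "\<not> f'" | "\<not> f" "f'" | "\<not> f" "\<not> f'" "k' = k" | "\<not> f" "\<not> f'" "k' = (\<not> k)"
          by blast
        then show ?thesis
        proof cases
          case 1
          then show ?thesis
            using normal normal' y Tip Sub invariant_vertices[OF xy] by (auto intro: theta_refl)
        next
          case 2
          then show ?thesis using far_near[of k'] xy y Tip Sub normal by auto
        next
          case 3
          then show ?thesis
            using far_near[of k] invariant_sym[OF xy] y Tip Sub normal' by (auto intro: theta_sym)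
        next
          case 4
          then show ?thesis
            using y Tip Sub invariant_vertices[OF xy] by (auto intro: theta_refl)
        next
          case 5
          then show ?thesis using near_near[of k] xy y Tip Sub by auto
        qed
      next
        case False
        \<comment> \<open>As \<open>y\<close> lies off the page and does not outrank
          \<open>x\<close>, every fold of the page sends it to \<open>Base\<close>. A fold moving
          \<open>x\<close> to a root tip therefore puts a colour into the ideal.\<close>
        have fold_y: "vertex_map (Fold (?P k' False)) y = Base" for k'
        proof (rule vertex_map_Fold_outside)
          show "rank y \<le> Suc (size (?P k' False))"
            using le Tip Sub by simp
          show "\<not> same_page (?P k' False) G" if "y = Tip G" for G
            using that False by (cases G) auto
        qed
        have colour: "col (?lab k') \<in> ?I" if "k' = k \<or> f" for k'
          by (rule detect[OF xy _ fold_y])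
            (use that Tip Sub in \<open>auto simp: vertex_map_Fold_page simp del: vertex_map.simps\<close>)
        \<comment> \<open>Collapsed edges lead from \<open>x\<close> down to an end of
          \<open>E\<close>: a single edge from a near vertex, two edges through
          \<open>z\<^sub>3\<close> from the middle.\<close>
        obtain w where w: "rank w \<le> Suc (size E)" "(w, x) \<in> \<theta> ?I"
        proof (cases f)
          case True
          have "(target E, Tip (?P False False)) \<in> \<theta> ?I"
            using in_theta[of False False] colour[of False] True by simp
          moreover have "(Tip (?P False False), x) \<in> \<theta> ?I"
            using in_theta[of True True] colour[of True] True normal Tip Sub by simp
          ultimately have "(target E, x) \<in> \<theta> ?I"
            by (rule theta_trans)
          then show ?thesis by (intro that[of "target E"]) auto
        next
          case False
          have "(if k then source E else target E, x) \<in> \<theta> ?I"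
            using in_theta[of k False] colour[of k] False Tip Sub by simp
          then show ?thesis
            by (intro that[of "if k then source E else target E"]) (auto simp: rank_source)
        qed
        have "(w, y) \<in> \<Theta>"
          using w(2) theta_root_colours_subset xy invariant_trans by blast
        moreover have "rank w + rank y < rank x + rank y"
          using w(1) Tip Sub by simp
        ultimately have "(w, y) \<in> \<theta> ?I" by (intro IH)
        with w(2) show ?thesis by (blast intro: theta_sym theta_trans)
      qed
    qed
  qed
  show ?case
  proof (cases "rank v \<le> rank u")
    case True
    then show ?thesis by (rule ordered[OF less.prems]) (rule less.hyps)
  next
    case False
    then have "(v, u) \<in> \<theta> ?I"
      by (intro ordered[OF invariant_sym[OF less.prems]])
        (simp_all add: less.hyps add.commute)
    then show ?thesis by (rule theta_sym)
  qed
qed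

lemma eq_theta_root_colours: "\<Theta> = \<theta> (root_colours \<Theta>)"
  using theta_root_colours_subset subset_theta_root_colours by auto

end

end


section \<open>The algebra of a coloured graph\<close>

text \<open>Vertices are taken modulo \<open>\<theta> {\<bottom>}\<close>, so that the identity
  becomes the congruence of the least ideal. The symbols given by \<open>code\<close> do not mention
  the semilattice, so that languages at different indices can be compared.\<close>

locale coded_colouring = semilattice_colouring L C col
  for L :: "'a gorder" (structure) and C :: "'c set" and col :: "'c \<Rightarrow> 'a" +
  fixes e :: "'c vertex \<Rightarrow> 'u" and code :: "'c operation \<Rightarrow> 'u" and decode :: "'u \<Rightarrow> 'c operation"
  assumes e_eq_iff: "u \<in> vertices \<Longrightarrow> v \<in> vertices \<Longrightarrow> e u = e v \<longleftrightarrow> (u, v) \<in> \<theta> {\<bottom>}"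
    and decode_code: "g \<in> operations \<Longrightarrow> decode (code g) = g"
begin

definition algebra :: "('u, 'u) unary_algebra" where
  "algebra = \<lparr>carrier = e ` vertices, lang = code ` operations,
     interp = (\<lambda>x u. e (vertex_map (decode x) (inv_into vertices e u)))\<rparr>"

lemma algebra_fields [simp]:
  "carrier algebra = e ` vertices" "lang algebra = code ` operations"
  by (simp_all add: algebra_def)

lemma e_inv_into: "u \<in> e ` vertices \<Longrightarrow> e (inv_into vertices e u) = u"
  by (rule f_inv_into_f)

lemma inv_into_vertices: "u \<in> e ` vertices \<Longrightarrow> inv_into vertices e u \<in> vertices"
  by (rule inv_into_into)

text \<open>The representative chosen in \<open>interp\<close> may differ from \<open>v\<close>, but
  only by \<open>\<theta> {\<bottom>}\<close>, which the operations preserve.\<close>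

lemma interp_code:
  assumes "g \<in> operations" "v \<in> vertices"
  shows "interp algebra (code g) (e v) = e (vertex_map g v)"
proof -
  let ?w = "inv_into vertices e (e v)"
  have w: "?w \<in> vertices" "e ?w = e v"
    using assms(2) by (auto intro: inv_into_vertices e_inv_into)
  then have "(vertex_map g ?w, vertex_map g v) \<in> \<theta> {\<bottom>}"
    using assms e_eq_iff by (blast intro: theta_vertex_map)
  then have "e (vertex_map g ?w) = e (vertex_map g v)"
    using w assms by (simp add: e_eq_iff vertex_map_closed)
  then show ?thesis
    using assms(1) by (simp add: algebra_def decode_code)
qed

lemma is_unary_algebra_algebra: "is_unary_algebra algebra"
  using Base_vertices
  by (auto simp: is_unary_algebra_def interp_code vertex_map_closed simp del: Base_vertices)

definition con :: "'a set \<Rightarrow> 'u rel" where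
  "con I = {(e u, e v) | u v. (u, v) \<in> \<theta> I}"

text \<open>Nothing is lost in passing to the quotient, because an ideal contains the bottom and so
  \<open>\<theta> I\<close> contains the kernel of \<open>e\<close>.\<close>

lemma con_iff:
  assumes "ideal I" "u \<in> vertices" "v \<in> vertices"
  shows "(e u, e v) \<in> con I \<longleftrightarrow> (u, v) \<in> \<theta> I"
proof
  assume "(e u, e v) \<in> con I"
  then obtain u' v' where uv: "e u = e u'" "e v = e v'" "(u', v') \<in> \<theta> I"
    by (auto simp: con_def)
  have "\<theta> {\<bottom>} \<subseteq> \<theta> I"
    using assms(1) by (intro theta_mono) (simp add: ideal_def)
  then have "(u, u') \<in> \<theta> I" "(v, v') \<in> \<theta> I"
    using uv assms theta_vertices[OF uv(3)] e_eq_iff by blast+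
  with uv(3) show "(u, v) \<in> \<theta> I"
    by (blast intro: theta_sym theta_trans)
qed (auto simp: con_def)

lemma congruence_con:
  assumes "ideal I" shows "congruence algebra (con I)"
  unfolding congruence_def
proof (intro conjI ballI)
  have subset: "con I \<subseteq> e ` vertices \<times> e ` vertices"
    by (auto simp: con_def dest: theta_vertices)
  show "equiv (carrier algebra) (con I)"
  proof (rule equivI)
    show "refl_on (carrier algebra) (con I)"
      by (auto simp: refl_on_def con_def intro: theta_refl)
    show "sym (con I)"
      by (auto simp: sym_def con_def intro: theta_sym)
    show "trans (con I)"
    proof (rule transI)
      fix x y z assume xyz: "(x, y) \<in> con I" "(y, z) \<in> con I"
      then obtain u v w where "u \<in> vertices" "v \<in> vertices" "w \<in> vertices"
        "x = e u" "y = e v" "z = e w"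
        using subset by blast
      with xyz show "(x, z) \<in> con I"
        using con_iff[OF assms] theta_trans by metis
    qed
    show "con I \<subseteq> carrier algebra \<times> carrier algebra"
      using subset by simp
  qed
next
  fix x p assume "x \<in> lang algebra" "p \<in> con I"
  then obtain g u v where g: "g \<in> operations" "x = code g" and p: "p = (e u, e v)" "(u, v) \<in> \<theta> I"
    by (auto simp: con_def)
  have "(e (vertex_map g u), e (vertex_map g v)) \<in> con I"
    using theta_vertex_map[OF p(2) g(1)] by (auto simp: con_def)
  then show "case p of (y, z) \<Rightarrow> (interp algebra x y, interp algebra x z) \<in> con I"
    using g p theta_vertices[OF p(2)] by (simp add: interp_code)
qed

lemma congruence_eq_con:
  assumes "congruence algebra \<alpha>"
  obtains I where "ideal I" "\<alpha> = con I"
proof -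
  \<comment> \<open>The pullback along \<open>e\<close> contains the kernel of \<open>e\<close>, so
    the classification of invariant equivalences applies.\<close>
  define \<Theta> where "\<Theta> = {(u, v) \<in> vertices \<times> vertices. (e u, e v) \<in> \<alpha>}"
  have \<alpha>: "equiv (e ` vertices) \<alpha>"
    using assms by (simp add: congruence_def)
  then have \<alpha>_refl: "x \<in> e ` vertices \<Longrightarrow> (x, x) \<in> \<alpha>"
    and \<alpha>_sym: "(x, y) \<in> \<alpha> \<Longrightarrow> (y, x) \<in> \<alpha>"
    and \<alpha>_trans: "(x, y) \<in> \<alpha> \<Longrightarrow> (y, z) \<in> \<alpha> \<Longrightarrow> (x, z) \<in> \<alpha>"
    and \<alpha>_sub: "\<alpha> \<subseteq> e ` vertices \<times> e ` vertices" for x y z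
    by (auto simp: equiv_def refl_on_def dest: symD transD)
  have equiv: "equiv vertices \<Theta>"
  proof (rule equivI)
    show "refl_on vertices \<Theta>"
      using \<alpha>_refl by (auto simp: refl_on_def \<Theta>_def)
    show "sym \<Theta>"
      using \<alpha>_sym by (auto simp: sym_def \<Theta>_def)
    show "trans \<Theta>"
      using \<alpha>_trans unfolding trans_def \<Theta>_def by blast
  qed (auto simp: \<Theta>_def)
  have bot: "\<theta> {\<bottom>} \<subseteq> \<Theta>"
    using \<alpha>_refl e_eq_iff theta_vertices by (fastforce simp: \<Theta>_def)
  have invariant: "(vertex_map g u, vertex_map g v) \<in> \<Theta>" if "g \<in> operations" "(u, v) \<in> \<Theta>" for g u v
  proof -
    have "(interp algebra (code g) (e u), interp algebra (code g) (e v)) \<in> \<alpha>"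
      using assms that by (auto simp: congruence_def \<Theta>_def)
    then show ?thesis
      using that by (auto simp: \<Theta>_def interp_code vertex_map_closed)
  qed
  have "\<alpha> = {(e u, e v) | u v. (u, v) \<in> \<Theta>}"
    using \<alpha>_sub by (fastforce simp: \<Theta>_def)
  also have "\<dots> = con (root_colours \<Theta>)"
    unfolding con_def using eq_theta_root_colours[OF equiv bot invariant] by simp
  finally show ?thesis
    using ideal_root_colours[OF equiv bot invariant] that by blast
qed

lemma con_root_iff:
  "ideal I \<Longrightarrow> c \<in> C \<Longrightarrow> (e Base, e (Tip (Root c))) \<in> con I \<longleftrightarrow> col c \<in> I"
  by (simp add: con_iff Tip_Root_vertices theta_Root_iff)

lemma con_mono: "I \<subseteq> J \<Longrightarrow> con I \<subseteq> con J"
  using theta_mono[of I J] by (auto simp: con_def)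

text \<open>Every congruence is some \<open>con J\<close>, and collapsing the root edge puts
  \<open>col c\<close> into \<open>J\<close>.\<close>

lemma con_down_subset:
  assumes "congruence algebra \<alpha>" "c \<in> C" "(e Base, e (Tip (Root c))) \<in> \<alpha>"
  shows "con (down (col c)) \<subseteq> \<alpha>"
proof -
  obtain J where J: "ideal J" "\<alpha> = con J"
    using assms(1) by (rule congruence_eq_con)
  then have "col c \<in> J"
    using assms con_root_iff by simp
  then show ?thesis
    using J by (simp add: con_mono ideal_down_subset)
qed

lemma con_down_le_iff:
  assumes "a \<in> carrier L" "b \<in> carrier L"
  shows "con (down a) \<subseteq> con (down b) \<longleftrightarrow> a \<sqsubseteq> b"
proof
  obtain c where c: "c \<in> C" "a = col c"
    using assms(1) unfolding col_image[symmetric] by (rule imageE)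
  assume "con (down a) \<subseteq> con (down b)"
  moreover have "(e Base, e (Tip (Root c))) \<in> con (down a)"
    using c assms by (simp add: con_root_iff ideal_down) (simp add: down_def)
  ultimately have "(e Base, e (Tip (Root c))) \<in> con (down b)"
    by blast
  then show "a \<sqsubseteq> b"
    using c assms by (simp add: con_root_iff ideal_down) (simp add: down_def)
qed (intro con_mono down_mono assms)

text \<open>Compactness: a path uses finitely many edges, and the join of their colours stays in the
  ideal.\<close>

lemma finite_subset_con_down:
  assumes "ideal I" "finite X" "X \<subseteq> con I"
  shows "\<exists>a\<in>I. X \<subseteq> con (down a)"
proof -
  have I: "I \<subseteq> carrier L" "\<bottom> \<in> I"
    using assms(1) by (simp_all add: ideal_def)
  have I_join: "a \<squnion> b \<in> I" if "a \<in> I" "b \<in> I" for a b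
  proof -
    have "a \<squnion> b \<in> carrier L" using that I(1) by (intro join_closed) auto
    then show ?thesis using that assms(1) le_refl unfolding ideal_def by blast
  qed
  have joinD: "down a \<subseteq> down (a \<squnion> b) \<and> down b \<subseteq> down (a \<squnion> b)" if "a \<in> I" "b \<in> I" for a b
    using that I(1) by (intro conjI down_mono join_left join_right join_closed) auto
  have bounded: "\<exists>a\<in>I. (u, v) \<in> \<theta> (down a)" if "(u, v) \<in> \<theta> I" for u v
    using that
  proof (induction rule: theta_induct)
    case (refl v)
    then show ?case using I(2) by (auto intro: theta_refl)
  next
    case (edge E)
    then have "col (label E) \<in> down (col (label E))"
      by (simp add: down_def)
    then show ?case using edge theta_edge by blast
  next
    case (sym u v)
    then show ?case by (blast intro: theta_sym)
  next
    case (trans u v w)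
    then obtain a b where "a \<in> I" "(u, v) \<in> \<theta> (down a)" "b \<in> I" "(v, w) \<in> \<theta> (down b)"
      by blast
    then have "(u, v) \<in> \<theta> (down (a \<squnion> b))" "(v, w) \<in> \<theta> (down (a \<squnion> b))" "a \<squnion> b \<in> I"
      using theta_mono[OF conjunct1[OF joinD[of a b]]] theta_mono[OF conjunct2[OF joinD[of a b]]]
        I_join by auto
    then show ?case by (blast intro: theta_trans)
  qed
  show ?thesis
    using assms(2,3)
  proof (induction rule: finite_induct)
    case empty
    then show ?case using I(2) by blast
  next
    case (insert p X)
    then obtain a where a: "a \<in> I" "X \<subseteq> con (down a)" by auto
    obtain u v where p: "p = (e u, e v)" "(u, v) \<in> \<theta> I"
      using insert.prems by (auto simp: con_def)
    then obtain b where b: "b \<in> I" "p \<in> con (down b)"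
      using bounded[OF p(2)] unfolding con_def by blast
    have "insert p X \<subseteq> con (down (a \<squnion> b))"
      using joinD[OF a(1) b(1)] a(2) b(2) con_mono by blast
    then show ?case using I_join a(1) b(1) by blast
  qed
qed

lemma congruence_hull:
  assumes "X \<subseteq> carrier algebra \<times> carrier algebra"
  shows "congruence algebra (congruence algebra hull X)"
proof -
  let ?F = "{\<alpha>. congruence algebra \<alpha> \<and> X \<subseteq> \<alpha>}"
  \<comment> \<open>The full relation is in the family, so the intersection stays inside the
    carrier.\<close>
  have full: "carrier algebra \<times> carrier algebra \<in> ?F"
    using assms
    by (auto simp: congruence_def equiv_def refl_on_def sym_def trans_def interp_code
      vertex_map_closed)
  have "equiv (carrier algebra) (\<Inter>?F)"
  proof (rule equivI)
    show "refl_on (carrier algebra) (\<Inter>?F)"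
      by (auto simp: refl_on_def congruence_def equiv_def)
    show "sym (\<Inter>?F)"
      by (auto simp: congruence_def equiv_def sym_def)
    show "trans (\<Inter>?F)"
      unfolding trans_def congruence_def equiv_def by blast
    show "\<Inter>?F \<subseteq> carrier algebra \<times> carrier algebra"
      using full by blast
  qed
  moreover have "(interp algebra x y, interp algebra x z) \<in> \<Inter>?F"
    if x: "x \<in> lang algebra" and yz: "(y, z) \<in> \<Inter>?F" for x y z
  proof
    fix \<alpha> assume \<alpha>: "\<alpha> \<in> ?F"
    then have "(y, z) \<in> \<alpha>" using yz by blast
    then show "(interp algebra x y, interp algebra x z) \<in> \<alpha>"
      using \<alpha> x unfolding congruence_def by blast
  qed
  ultimately show ?thesis
    unfolding hull_def congruence_def[of algebra "\<Inter>?F"] by blast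
qed

lemma hull_root:
  assumes "c \<in> C"
  shows "congruence algebra hull {(e Base, e (Tip (Root c)))} = con (down (col c))"
proof (rule hull_unique)
  show "congruence algebra (con (down (col c)))"
    using assms by (simp add: congruence_con ideal_down)
  have "col c \<in> down (col c)"
    using assms by (simp add: down_def)
  then show "{(e Base, e (Tip (Root c)))} \<subseteq> con (down (col c))"
    using assms by (simp add: con_root_iff ideal_down)
qed (use assms con_down_subset in auto)

lemma carrier_Con_c: "carrier (Con_c algebra) = (\<lambda>a. con (down a)) ` carrier L"
proof (intro subset_antisym subsetI)
  fix \<alpha> assume "\<alpha> \<in> carrier (Con_c algebra)"
  then obtain X where X: "finite X" "X \<subseteq> carrier algebra \<times> carrier algebra"
    and \<alpha>: "\<alpha> = congruence algebra hull X"
    by (auto simp: Con_c_def)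
  obtain I where I: "ideal I" "\<alpha> = con I"
    using congruence_eq_con[OF congruence_hull[OF X(2)]] \<alpha> by blast
  \<comment> \<open>A finite generating set needs only one element of the ideal, so the generated
    congruence is already that of a principal ideal.\<close>
  then obtain a where a: "a \<in> I" "X \<subseteq> con (down a)"
    using finite_subset_con_down X(1) hull_subset[of X "congruence algebra"] \<alpha> by blast
  then have "a \<in> carrier L"
    using I(1) by (auto simp: ideal_def)
  then have "\<alpha> \<subseteq> con (down a)"
    unfolding \<alpha> by (intro hull_minimal a congruence_con ideal_down)
  moreover have "con (down a) \<subseteq> \<alpha>"
    using I a by (simp add: con_mono ideal_down_subset)
  ultimately show "\<alpha> \<in> (\<lambda>a. con (down a)) ` carrier L"
    using \<open>a \<in> carrier L\<close> by blast
next
  fix \<alpha> assume "\<alpha> \<in> (\<lambda>a. con (down a)) ` carrier L"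
  then obtain c where c: "c \<in> C" "\<alpha> = con (down (col c))"
    unfolding col_image[symmetric] by blast
  then have "\<alpha> = congruence algebra hull {(e Base, e (Tip (Root c)))}"
    by (simp add: hull_root)
  then show "\<alpha> \<in> carrier (Con_c algebra)"
    unfolding Con_c_def using c(1) by (auto intro!: exI[of _ "{(e Base, e (Tip (Root c)))}"] Tip_Root_vertices)
qed

end


text \<open>Join and bottom are chosen least elements of sets described by the order, and an order
  isomorphism transports least elements.\<close>

lemma join_0_iso_inv_into:
  fixes M :: "'a gorder" (structure) and N :: "'b gorder"
  assumes "join_semilattice_0 M" and bij: "bij_betw f (carrier M) (carrier N)"
    and le: "\<And>x y. x \<in> carrier M \<Longrightarrow> y \<in> carrier M \<Longrightarrow> f x \<sqsubseteq>\<^bsub>N\<^esub> f y \<longleftrightarrow> x \<sqsubseteq> y"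
  shows "join_0_iso N M (inv_into (carrier M) f)"
proof -
  interpret join_semilattice_0 M by fact
  let ?h = "inv_into (carrier M) f"
  have h: "?h x \<in> carrier M" "f (?h x) = x" if "x \<in> carrier N" for x
    using that bij by (auto simp: bij_betw_def inv_into_into f_inv_into_f)
  have hf: "?h (f x) = x" if "x \<in> carrier M" for x
    using that bij by (simp add: bij_betw_def)
  have f: "f x \<in> carrier N" if "x \<in> carrier M" for x
    using that bij by (auto simp: bij_betw_def)
  have le': "x \<sqsubseteq>\<^bsub>N\<^esub> y \<longleftrightarrow> ?h x \<sqsubseteq> ?h y" if "x \<in> carrier N" "y \<in> carrier N" for x y
    using le[of "?h x" "?h y"] h that by simp
  have least_iff: "least N z A \<longleftrightarrow> least M (?h z) (?h ` A)" if "z \<in> carrier N" "A \<subseteq> carrier N" for z A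
  proof -
    have "?h z \<in> ?h ` A \<longleftrightarrow> z \<in> A"
      using bij_betw_inv_into[OF bij] that by (intro inj_on_image_mem_iff) (auto simp: bij_betw_def)
    moreover have "?h ` A \<subseteq> carrier M"
      using that h by blast
    moreover have "(\<forall>x\<in>A. z \<sqsubseteq>\<^bsub>N\<^esub> x) \<longleftrightarrow> (\<forall>x\<in>A. ?h z \<sqsubseteq> ?h x)"
      using that le' by blast
    ultimately show ?thesis
      using that by (simp add: least_def)
  qed
  \<comment> \<open>Uniqueness of least elements in \<open>N\<close> is pulled back from
    \<open>M\<close>; it makes the choice operator in join and bottom determinate.\<close>
  have unique: "z = f m" if "least N z A" "least M m (?h ` A)" for z m A
  proof -
    have "z \<in> carrier N" "A \<subseteq> carrier N"
      using that(1) by (auto simp: least_def)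
    then have "least M (?h z) (?h ` A)"
      using least_iff that(1) by blast
    then have "?h z = m"
      using that(2) least_unique by blast
    then show ?thesis using h(2)[OF \<open>z \<in> carrier N\<close>] by simp
  qed
  have least_f: "least N (f m) A" if "least M m (?h ` A)" "A \<subseteq> carrier N" for m A
  proof -
    have "m \<in> carrier M" using that(1) by (rule least_closed)
    then show ?thesis using that least_iff[of "f m" A] f hf by simp
  qed
  have some: "(SOME z. least N z A) = f m" if "least M m (?h ` A)" "A \<subseteq> carrier N" for m A
    by (rule some_equality) (rule least_f[OF that], rule unique[OF _ that(1)])
  have "?h (x \<squnion>\<^bsub>N\<^esub> y) = ?h x \<squnion> ?h y" if xy: "x \<in> carrier N" "y \<in> carrier N" for x y
  proof -
    have "?h ` Upper N {x, y} = Upper M {?h x, ?h y}"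
    proof (intro subset_antisym subsetI)
      fix u assume u: "u \<in> Upper M {?h x, ?h y}"
      then have "u \<in> carrier M" by (auto simp: Upper_def)
      moreover from this have "f u \<in> Upper N {x, y}"
        using u xy h f hf le' by (auto simp: Upper_def)
      ultimately show "u \<in> ?h ` Upper N {x, y}"
        using hf by (metis imageI)
    qed (use xy h le' in \<open>auto simp: Upper_def\<close>)
    moreover have "least M (?h x \<squnion> ?h y) (Upper M {?h x, ?h y})"
      by (rule joinI[where P = "\<lambda>l. least M l (Upper M {?h x, ?h y})"]) (simp_all add: h xy)
    ultimately have "x \<squnion>\<^bsub>N\<^esub> y = f (?h x \<squnion> ?h y)"
      unfolding join_def[of N] sup_def by (intro some) (auto simp: Upper_def)
    then show ?thesis using hf h xy by simp
  qed
  moreover have "?h ` carrier N = carrier M"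
    using bij_betw_inv_into[OF bij] by (simp add: bij_betw_def)
  moreover from this have "\<bottom>\<^bsub>N\<^esub> = f \<bottom>"
    unfolding bottom_def[of N] using bottom_least by (intro some) auto
  moreover have "bij_betw ?h (carrier N) (carrier M)"
    using bij by (rule bij_betw_inv_into)
  ultimately show ?thesis
    using hf h by (auto simp: join_0_iso_def join_0_hom_def)
qed

context coded_colouring
begin

lemma bij_con_down: "bij_betw (\<lambda>a. con (down a)) (carrier L) (carrier (Con_c algebra))"
  unfolding bij_betw_def carrier_Con_c
proof (intro conjI inj_onI)
  fix a b assume "a \<in> carrier L" "b \<in> carrier L" "con (down a) = con (down b)"
  then show "a = b"
    using con_down_le_iff[of a b] con_down_le_iff[of b a] by (intro le_antisym) simp_all
qed simp

lemma Con_c_iso: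
  "join_0_iso (Con_c algebra) L (inv_into (carrier L) (\<lambda>a. con (down a)))"
  by (rule join_0_iso_inv_into[OF _ bij_con_down])
    (unfold_locales, simp add: Con_c_def con_down_le_iff)

end


section \<open>Functoriality\<close>

text \<open>A label keeps its name while its colour moves along \<open>h\<close>, and both algebras
  share \<open>code\<close>, so common operations have the same symbol.\<close>

locale colouring_hom =
  L: coded_colouring L C col e code decode + M: coded_colouring M D col' e' code decode
  for L :: "'a gorder" and C :: "'c set" and col e and code :: "'c operation \<Rightarrow> 'u" and decode
    and M :: "'b gorder" and D :: "'c set" and col' e' +
  fixes h :: "'a \<Rightarrow> 'b"
  assumes hom: "join_0_hom L M h" and labels: "C \<subseteq> D"
    and colours: "c \<in> C \<Longrightarrow> col' c = h (col c)"
begin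

lemma h_closed [simp]: "a \<in> carrier L \<Longrightarrow> h a \<in> carrier M"
  using hom by (auto simp: join_0_hom_def)

lemma h_join: "a \<in> carrier L \<Longrightarrow> b \<in> carrier L \<Longrightarrow> h (a \<squnion>\<^bsub>L\<^esub> b) = h a \<squnion>\<^bsub>M\<^esub> h b"
  using hom by (simp add: join_0_hom_def)

lemma h_bot: "h \<bottom>\<^bsub>L\<^esub> = \<bottom>\<^bsub>M\<^esub>"
  using hom by (simp add: join_0_hom_def)

lemma h_mono:
  assumes "a \<sqsubseteq>\<^bsub>L\<^esub> b" "a \<in> carrier L" "b \<in> carrier L"
  shows "h a \<sqsubseteq>\<^bsub>M\<^esub> h b"
proof -
  have "a \<squnion>\<^bsub>L\<^esub> b = b"
    using assms by (intro L.le_antisym L.join_le L.join_right L.join_closed L.le_refl)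
  then have "h b = h a \<squnion>\<^bsub>M\<^esub> h b"
    using h_join assms by metis
  then show ?thesis
    using M.join_left[of "h a" "h b"] assms by simp
qed

text \<open>The condition for attaching a page is an inequality with a join, and \<open>h\<close>
  preserves it.\<close>

lemma edges_subset: "L.edges \<subseteq> M.edges"
proof
  fix E assume "E \<in> L.edges"
  then show "E \<in> M.edges"
  proof (induction rule: L.edges.induct)
    case (Root c)
    then show ?case using labels by (blast intro: M.edges.Root)
  next
    case (Sub E a b k f)
    have "h (col (label E)) \<sqsubseteq>\<^bsub>M\<^esub> h (col a) \<squnion>\<^bsub>M\<^esub> h (col b)"
      using h_mono[OF Sub.hyps(4)] Sub.hyps by (simp add: h_join)
    then show ?case
      using Sub labels by (intro M.edges.Sub) (auto simp: colours)
  qed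
qed

lemma vertices_subset: "L.vertices \<subseteq> M.vertices"
  using edges_subset by (auto simp: L.vertices_def M.vertices_def)

lemma operations_subset: "L.operations \<subseteq> M.operations"
  using edges_subset by (auto simp: L.operations_def M.operations_def)

lemma theta_subset:
  assumes "h ` I \<subseteq> J" shows "L.\<theta> I \<subseteq> M.\<theta> J"
proof -
  have "(u, v) \<in> M.\<theta> J" if "(u, v) \<in> L.\<theta> I" for u v
    using that
  proof (induction rule: L.theta_induct)
    case (refl v)
    then show ?case using vertices_subset by (auto intro: M.theta_refl)
  next
    case (edge E)
    then show ?case
      using edges_subset assms by (intro M.theta_edge) (auto simp: colours)
  qed (auto intro: M.theta_sym M.theta_trans)
  then show ?thesis by auto
qed

definition transition :: "'u \<Rightarrow> 'u" where
  "transition u = e' (inv_into L.vertices e u)"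

text \<open>Since \<open>h\<close> preserves the bottom, vertices identified over \<open>L\<close>
  remain identified over \<open>M\<close>, and the chosen representative does not matter.\<close>

lemma transition_e:
  assumes "v \<in> L.vertices" shows "transition (e v) = e' v"
proof -
  let ?w = "inv_into L.vertices e (e v)"
  have w: "?w \<in> L.vertices" "e ?w = e v"
    using assms by (auto intro: L.inv_into_vertices L.e_inv_into)
  then have "(?w, v) \<in> L.\<theta> {\<bottom>\<^bsub>L\<^esub>}"
    using assms L.e_eq_iff by blast
  then have "(?w, v) \<in> M.\<theta> {\<bottom>\<^bsub>M\<^esub>}"
    using theta_subset[of "{\<bottom>\<^bsub>L\<^esub>}" "{\<bottom>\<^bsub>M\<^esub>}"] h_bot by auto
  then show ?thesis
    unfolding transition_def using w assms vertices_subset M.e_eq_iff by blast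
qed

lemma malg_hom_transition: "malg_hom L.algebra M.algebra transition"
  unfolding malg_hom_def
proof (intro conjI ballI)
  show "lang L.algebra \<subseteq> lang M.algebra"
    using operations_subset by auto
  show "transition \<in> carrier L.algebra \<rightarrow> carrier M.algebra"
    using vertices_subset by (auto simp: transition_e)
next
  fix x u assume "x \<in> lang L.algebra" "u \<in> carrier L.algebra"
  then obtain g v where g: "g \<in> L.operations" "x = code g" and v: "v \<in> L.vertices" "u = e v"
    by auto
  have "g \<in> M.operations" "v \<in> M.vertices"
    using g v operations_subset vertices_subset by auto
  then show "transition (interp L.algebra x u) = interp M.algebra x (transition u)"
    using g v by (simp add: L.interp_code M.interp_code transition_e L.vertex_map_closed)
qed

text \<open>A root edge of colour \<open>a\<close> has colour \<open>h a\<close> over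
  \<open>M\<close>, and collapsing this one edge generates the right-hand side.\<close>

lemma Con_c_map_transition:
  assumes "a \<in> carrier L"
  shows "Con_c_map M.algebra transition (L.con (L.down a)) = M.con (M.down (h a))"
  unfolding Con_c_map_def
proof (rule hull_unique)
  let ?X = "{(transition x, transition y) | x y. (x, y) \<in> L.con (L.down a)}"
  have X: "?X = {(e' u, e' v) | u v. (u, v) \<in> L.\<theta> (L.down a)}"
  proof (intro subset_antisym subsetI)
    fix p assume "p \<in> ?X"
    then obtain u v where "p = (transition (e u), transition (e v))" "(u, v) \<in> L.\<theta> (L.down a)"
      by (auto simp: L.con_def)
    then show "p \<in> {(e' u, e' v) | u v. (u, v) \<in> L.\<theta> (L.down a)}"
      using L.theta_vertices[of u v] by (auto simp: transition_e)
  next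
    fix p assume "p \<in> {(e' u, e' v) | u v. (u, v) \<in> L.\<theta> (L.down a)}"
    then obtain u v where "p = (e' u, e' v)" "(u, v) \<in> L.\<theta> (L.down a)"
      by blast
    then have "p = (transition (e u), transition (e v))" "(e u, e v) \<in> L.con (L.down a)"
      using L.theta_vertices[of u v] by (auto simp: transition_e L.con_def)
    then show "p \<in> ?X" by blast
  qed
  have "h ` L.down a \<subseteq> M.down (h a)"
    using assms h_mono by (auto simp: L.down_def M.down_def)
  from theta_subset[OF this] show "?X \<subseteq> M.con (M.down (h a))"
    unfolding X M.con_def by blast
  show "congruence M.algebra (M.con (M.down (h a)))"
    using assms by (simp add: M.congruence_con M.ideal_down)
  fix \<alpha> assume \<alpha>: "?X \<subseteq> \<alpha>" "congruence M.algebra \<alpha>"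
  obtain c where c: "c \<in> C" "a = col c"
    using assms unfolding L.col_image[symmetric] by (rule imageE)
  have "(Base, Tip (Root c)) \<in> L.\<theta> (L.down a)"
    using c by (simp add: L.theta_Root_iff L.ideal_down) (simp add: L.down_def)
  then have "(e' Base, e' (Tip (Root c))) \<in> \<alpha>"
    using \<alpha>(1) unfolding X by blast
  then have "M.con (M.down (col' c)) \<subseteq> \<alpha>"
    using c(1) labels by (intro M.con_down_subset \<alpha>) auto
  then show "M.con (M.down (h a)) \<subseteq> \<alpha>"
    using c by (simp add: colours)
qed

end


section \<open>Smallness\<close>

lemma infinite_universe: "set_universe (U :: 'u itself) \<Longrightarrow> infinite (UNIV :: 'u set)"
  using countable_finite by (auto simp: set_universe_def)

lemma small_nat:
  assumes "set_universe (U :: 'u itself)" shows "small U (UNIV :: nat set)"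
proof -
  have "\<not> ( |UNIV :: 'u set| \<le>o |UNIV :: nat set| )"
    using assms unfolding set_universe_def card_of_ordLeq[symmetric] countable_def by blast
  then show ?thesis
    unfolding small_def by (simp add: not_ordLeq_iff_ordLess card_of_Well_order)
qed

lemma small_mono: "small U B \<Longrightarrow> |A| \<le>o |B| \<Longrightarrow> small U A"
  unfolding small_def by (rule ordLeq_ordLess_trans)

lemma small_subset: "small U B \<Longrightarrow> A \<subseteq> B \<Longrightarrow> small U A"
  by (rule small_mono[OF _ card_of_mono1])

lemma small_image: "small U A \<Longrightarrow> small U (f ` A)"
  by (rule small_mono[OF _ card_of_image])

lemma small_Plus:
  "set_universe U \<Longrightarrow> small U A \<Longrightarrow> small U B \<Longrightarrow> small U (A <+> B)"
  unfolding small_def by (rule card_of_Plus_ordLess_infinite[OF infinite_universe])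

lemma small_Times:
  assumes "set_universe U" "small U A" "small U B" shows "small U (A \<times> B)"
proof -
  \<comment> \<open>Adding the natural numbers makes the sum infinite, hence equinumerous with its
    square.\<close>
  let ?W = "(A <+> B) <+> (UNIV :: nat set)"
  have "|A \<times> B| \<le>o |?W \<times> ?W|"
    unfolding card_of_ordLeq[symmetric]
    by (intro exI[of _ "\<lambda>(a, b). (Inl (Inl a), Inl (Inr b))"]) (auto simp: inj_on_def)
  also have "|?W \<times> ?W| =o |?W|"
    by (intro card_of_Times_same_infinite) (simp add: finite_Plus_iff)
  finally show ?thesis
    using small_Plus[OF assms(1) small_Plus[OF assms] small_nat[OF assms(1)]]
    by (rule small_mono[rotated])
qed

lemma small_Un:
  assumes "set_universe U" "small U A" "small U B" shows "small U (A \<union> B)"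
  by (rule small_mono[OF small_Plus[OF assms] card_of_Un_Plus_ordLeq])

lemma small_inj_on:
  assumes "small (U :: 'u itself) A"
  obtains g :: "'a \<Rightarrow> 'u" where "inj_on g A"
proof -
  have "|A| \<le>o |UNIV :: 'u set|"
    using assms unfolding small_def by (rule ordLess_imp_ordLeq)
  then show ?thesis
    unfolding card_of_ordLeq[symmetric] using that by blast
qed

text \<open>Here \<open>h\<close> stands for a pairing function. Tag 0 marks roots, tags 1 to 4 the
  positions on a page.\<close>

primrec edge_code :: "(('c + nat) \<times> ('c + nat) \<Rightarrow> 'c + nat) \<Rightarrow> 'c edge \<Rightarrow> 'c + nat" where
  "edge_code h (Root c) = h (Inr 0, Inl c)"
| "edge_code h (Sub E a b k f) =
     h (Inr (Suc (of_bool k + 2 * of_bool f)), h (edge_code h E, h (Inl a, Inl b)))"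

lemma small_edges:
  assumes "set_universe U" "small U D"
  shows "small U {E. set_edge E \<subseteq> D}"
proof -
  define W where "W = D <+> (UNIV :: nat set)"
  have W [simp]: "Inl c \<in> W \<longleftrightarrow> c \<in> D" "Inr n \<in> W" for c n
    by (auto simp: W_def)
  have "infinite W"
    by (simp add: W_def finite_Plus_iff)
  then have "|W \<times> W| \<le>o |W|"
    by (intro ordIso_imp_ordLeq card_of_Times_same_infinite)
  then obtain h where h: "inj_on h (W \<times> W)" "h ` (W \<times> W) \<subseteq> W"
    unfolding card_of_ordLeq[symmetric] by blast
  have h_eq: "h (x, y) = h (x', y') \<longleftrightarrow> x = x' \<and> y = y'"
    if "x \<in> W" "y \<in> W" "x' \<in> W" "y' \<in> W" for x y x' y'
    using inj_on_eq_iff[OF h(1), of "(x, y)" "(x', y')"] that by simp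
  have h_closed: "h (x, y) \<in> W" if "x \<in> W" "y \<in> W" for x y
    using h(2) that by blast
  have closed: "edge_code h E \<in> W" if "set_edge E \<subseteq> D" for E
    using that by (induction E) (simp_all add: h_closed)
  have inj: "E = F" if "set_edge E \<subseteq> D" "set_edge F \<subseteq> D" "edge_code h E = edge_code h F" for E F
    using that
  proof (induction E arbitrary: F)
    case (Root c)
    then show ?case by (cases F) (simp_all add: h_eq closed h_closed)
  next
    case (Sub E a b k f)
    show ?case
    proof (cases F)
      case (Root c)
      then show ?thesis using Sub.prems by (simp add: h_eq closed h_closed)
    next
      case F: (Sub E' a' b' k' f')
      have "of_bool k + 2 * of_bool f = (of_bool k' + 2 * of_bool f' :: nat)"
        and "edge_code h E = edge_code h E'" "a = a'" "b = b'"
        using Sub.prems F by (simp_all add: h_eq closed h_closed)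
      then show ?thesis
        using Sub F by (cases k; cases k'; cases f; cases f') auto
    qed
  qed
  have "|{E. set_edge E \<subseteq> D}| \<le>o |W|"
    unfolding card_of_ordLeq[symmetric] using closed inj
    by (intro exI[of _ "edge_code h"]) (auto intro!: inj_onI)
  then show ?thesis
    using small_Plus[OF assms small_nat[OF assms(1)]] unfolding W_def by (rule small_mono[rotated])
qed

text \<open>Compose \<open>g\<close> with a choice of class representatives. Staying inside the
  image of \<open>g\<close> later bounds all carriers by one small set.\<close>

lemma equiv_code:
  assumes "equiv A R" "inj_on g A"
  obtains e where "\<And>u v. u \<in> A \<Longrightarrow> v \<in> A \<Longrightarrow> e u = e v \<longleftrightarrow> (u, v) \<in> R" "e ` A \<subseteq> g ` A"
proof -
  define rep where "rep v = (SOME w. (v, w) \<in> R)" for v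
  have rep: "(v, rep v) \<in> R" "rep v \<in> A" if "v \<in> A" for v
  proof -
    have "(v, v) \<in> R"
      using assms(1) that by (auto simp: equiv_def refl_on_def)
    then show "(v, rep v) \<in> R"
      unfolding rep_def by (rule someI)
    then show "rep v \<in> A"
      using assms(1) by (auto simp: equiv_def)
  qed
  have "rep u = rep v \<longleftrightarrow> (u, v) \<in> R" if "u \<in> A" "v \<in> A" for u v
  proof
    assume "(u, v) \<in> R"
    \<comment> \<open>Related elements have the same class, hence the same chosen
      representative.\<close>
    then have "(u, w) \<in> R \<longleftrightarrow> (v, w) \<in> R" for w
      using assms(1) by (meson equivE symD transD)
    then show "rep u = rep v"
      by (simp add: rep_def)
  next
    assume "rep u = rep v"
    then show "(u, v) \<in> R"
      using rep(1) that assms(1) by (metis equivE symD transD)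
  qed
  then show ?thesis
    using rep(2) assms(2) by (intro that[of "g \<circ> rep"]) (auto simp: inj_on_eq_iff)
qed

lemma (in semilattice_colouring) edges_labels: "E \<in> edges \<Longrightarrow> set_edge E \<subseteq> C"
  by (induction rule: edges.induct) auto

section \<open>Assembling the diagram of algebras\<close>

theorem mainTheorem5:
  fixes P :: "'p set" and r :: "'p rel"
    and S :: "'p \<Rightarrow> 's gorder" and s :: "'p \<Rightarrow> 'p \<Rightarrow> 's \<Rightarrow> 's"
  assumes "set_universe TYPE('u)"
    and "erdos_cardinals_proper TYPE('u)"
    and "P \<noteq> {}" and "partial_order_on P r" and "small TYPE('u) P"
    and "semilattice_diagram P r S s" and "small TYPE('u) (\<Union>p\<in>P. carrier (S p))"
  shows "\<exists>(B :: 'p \<Rightarrow> ('u, 'u) unary_algebra) (b :: 'p \<Rightarrow> 'p \<Rightarrow> 'u \<Rightarrow> 'u).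
           malg_diagram P r B b \<and>
           small TYPE('u) (\<Union>p\<in>P. carrier (B p)) \<and> small TYPE('u) (\<Union>p\<in>P. lang (B p)) \<and>
           naturally_isomorphic P r
             (\<lambda>p. Con_c (B p)) (\<lambda>p q. Con_c_map (B q) (b p q)) S s"
proof -
  have r: "r \<subseteq> P \<times> P" "\<And>p. p \<in> P \<Longrightarrow> (p, p) \<in> r"
    "\<And>p q t. (p, q) \<in> r \<Longrightarrow> (q, t) \<in> r \<Longrightarrow> (p, t) \<in> r"
    using assms(4) by (auto simp: partial_order_on_def preorder_on_def refl_on_def dest: transD)
  have S: "\<And>p. p \<in> P \<Longrightarrow> join_semilattice_0 (S p)"
    "\<And>p q. (p, q) \<in> r \<Longrightarrow> join_0_hom (S p) (S q) (s p q)"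
    "\<And>p x. p \<in> P \<Longrightarrow> x \<in> carrier (S p) \<Longrightarrow> s p p x = x"
    "\<And>p q t x. (p, q) \<in> r \<Longrightarrow> (q, t) \<in> r \<Longrightarrow> x \<in> carrier (S p) \<Longrightarrow> s q t (s p q x) = s p t x"
    using assms(6) by (auto simp: poset_diagram_def)

  define C where "C q = {(p, a). (p, q) \<in> r \<and> a \<in> carrier (S p)}" for q
  define col where "col q = (\<lambda>(p, a). s p q a)" for q
  have colouring: "semilattice_colouring (S q) (C q) (col q)" if "q \<in> P" for q
  proof (intro semilattice_colouring.intro semilattice_colouring_axioms.intro)
    show "join_semilattice_0 (S q)"
      by (rule S(1)[OF that])
    show "col q ` C q = carrier (S q)"
    proof (intro subset_antisym subsetI)
      \<comment> \<open>The label \<open>(q, x)\<close> has colour \<open>s q q x\<close>, which is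
        \<open>x\<close>.\<close>
      fix x assume "x \<in> carrier (S q)"
      then show "x \<in> col q ` C q"
        using that r(2) S(3) by (intro image_eqI[of _ _ "(q, x)"]) (auto simp: C_def col_def)
    next
      fix x assume "x \<in> col q ` C q"
      then obtain p a where pa: "(p, q) \<in> r" "a \<in> carrier (S p)" "x = s p q a"
        by (auto simp: C_def col_def)
      then show "x \<in> carrier (S q)"
        using S(2)[OF pa(1)] by (auto simp: join_0_hom_def)
    qed
  qed

  \<comment> \<open>One label set for all indices: a single \<open>g\<close> and a single
    \<open>code\<close> then serve everywhere and keep the unions of carriers and languages
    small.\<close>
  define D where "D = P \<times> (\<Union>p\<in>P. carrier (S p))"
  have C_D: "C q \<subseteq> D" for q
    using r(1) by (auto simp: C_def D_def)
  let ?E = "{E. set_edge E \<subseteq> D}"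
  let ?V = "insert Base (Tip ` ?E)" and ?O = "Shift ` ?E \<union> Fold ` ?E"
  have small_E: "small TYPE('u) ?E"
    unfolding D_def by (intro small_edges small_Times assms)
  \<comment> \<open>The constant range is just the singleton of \<open>Base\<close>, whose smallness
    comes from that of the natural numbers.\<close>
  have "small TYPE('u) (range (\<lambda>_ :: nat. Base) \<union> Tip ` ?E)"
    by (intro small_Un small_image small_nat small_E assms)
  then have small_V: "small TYPE('u) ?V"
    by simp
  have small_O: "small TYPE('u) ?O"
    by (intro small_Un small_image small_E assms)
  obtain g :: "('p \<times> 's) vertex \<Rightarrow> 'u" where g: "inj_on g ?V"
    using small_V by (rule small_inj_on)
  obtain code :: "('p \<times> 's) operation \<Rightarrow> 'u" where code: "inj_on code ?O"
    using small_O by (rule small_inj_on)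
  define decode where "decode = inv_into ?O code"

  define V where "V q = semilattice_colouring.vertices (S q) (C q) (col q)" for q
  define \<Theta> where "\<Theta> q = semilattice_colouring.\<theta> (S q) (C q) (col q) {\<bottom>\<^bsub>S q\<^esub>}" for q
  have V_subset: "V q \<subseteq> ?V" if "q \<in> P" for q
  proof -
    interpret semilattice_colouring "S q" "C q" "col q" by (rule colouring[OF that])
    have "v \<in> ?V" if v: "v \<in> vertices" for v
      using v Tip_edges edges_labels C_D by (cases v) blast+
    then show ?thesis by (auto simp: V_def)
  qed
  have "\<exists>e :: ('p \<times> 's) vertex \<Rightarrow> 'u.
      (\<forall>u\<in>V q. \<forall>v\<in>V q. e u = e v \<longleftrightarrow> (u, v) \<in> \<Theta> q) \<and> e ` V q \<subseteq> g ` V q" if "q \<in> P" for q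
  proof -
    interpret semilattice_colouring "S q" "C q" "col q" by (rule colouring[OF that])
    have "equiv (V q) (\<Theta> q)"
      unfolding V_def \<Theta>_def by (rule equiv_theta)
    then show ?thesis
      using inj_on_subset[OF g V_subset[OF that]] by (rule equiv_code) blast
  qed
  then obtain e :: "'p \<Rightarrow> ('p \<times> 's) vertex \<Rightarrow> 'u"
    where e: "\<And>q u v. q \<in> P \<Longrightarrow> u \<in> V q \<Longrightarrow> v \<in> V q \<Longrightarrow> e q u = e q v \<longleftrightarrow> (u, v) \<in> \<Theta> q"
      "\<And>q. q \<in> P \<Longrightarrow> e q ` V q \<subseteq> g ` V q"
    by metis

  have operations_subset: "semilattice_colouring.operations (S q) (C q) (col q) \<subseteq> ?O" if "q \<in> P" for q
  proof -
    interpret semilattice_colouring "S q" "C q" "col q" by (rule colouring[OF that])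
    have "h \<in> ?O" if "h \<in> operations" for h
    proof -
      have "op_edge h \<in> ?E"
        using that edges_labels C_D unfolding operations_def by blast
      then show ?thesis by (cases h) simp_all
    qed
    then show ?thesis by blast
  qed
  have coded: "coded_colouring (S q) (C q) (col q) (e q) code decode" if "q \<in> P" for q
  proof (intro coded_colouring.intro coded_colouring_axioms.intro colouring that)
    fix h assume "h \<in> semilattice_colouring.operations (S q) (C q) (col q)"
    then show "decode (code h) = h"
      using operations_subset[OF that] code unfolding decode_def by (intro inv_into_f_f) auto
  qed (use e(1)[OF that] in \<open>simp add: V_def \<Theta>_def\<close>)
  \<comment> \<open>Transitivity gives \<open>C p \<subseteq> C q\<close>, and the composition law
    for \<open>s\<close> gives the compatibility of colours.\<close>
  have hom: "colouring_hom (S p) (C p) (col p) (e p) code decode (S q) (C q) (col q) (e q) (s p q)"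
    if "(p, q) \<in> r" for p q
    using that r S
    by (intro colouring_hom.intro colouring_hom_axioms.intro coded) (auto simp: C_def col_def)

  define B where "B q = coded_colouring.algebra (S q) (C q) (col q) (e q) code decode" for q
  define b where "b p q = colouring_hom.transition (S p) (C p) (col p) (e p) (e q)" for p q
  \<comment> \<open>Reads off \<open>a\<close> from the congruence of its principal ideal;
    naturality then follows from \<open>Con_c_map_transition\<close>.\<close>
  define \<eta> where "\<eta> q = inv_into (carrier (S q)) (\<lambda>a. coded_colouring.con (S q) (C q) (col q) (e q)
    (semilattice_colouring.down (S q) a))" for q
  have carrier_B: "carrier (B q) = e q ` V q" if "q \<in> P" for q
    using coded_colouring.algebra_fields(1)[OF coded[OF that]] by (simp add: B_def V_def)
  have b_e: "b p q (e p v) = e q v" if "(p, q) \<in> r" "v \<in> V p" for p q v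
    using colouring_hom.transition_e[OF hom] that by (simp add: b_def V_def)
  have V_mono: "V p \<subseteq> V q" if "(p, q) \<in> r" for p q
    unfolding V_def by (rule colouring_hom.vertices_subset[OF hom[OF that]])

  have "malg_diagram P r B b"
    unfolding poset_diagram_def
  proof (intro conjI ballI allI impI)
    show "is_unary_algebra (B p)" if "p \<in> P" for p
      unfolding B_def by (rule coded_colouring.is_unary_algebra_algebra[OF coded[OF that]])
    show "case x of (p, q) \<Rightarrow> malg_hom (B p) (B q) (b p q)" if "x \<in> r" for x
      using that by (auto simp: B_def b_def intro: colouring_hom.malg_hom_transition hom)
    show "b p p x = x" if "p \<in> P" "x \<in> carrier (B p)" for p x
      using that b_e r(2) by (auto simp: carrier_B)
    show "b q t (b p q x) = b p t x" if pqt: "(p, q) \<in> r \<and> (q, t) \<in> r" and x: "x \<in> carrier (B p)"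
      for p q t x
    proof -
      have "p \<in> P" using pqt r(1) by blast
      then obtain v where "v \<in> V p" "x = e p v"
        using x by (auto simp: carrier_B)
      moreover have "(p, t) \<in> r" using pqt r(3) by blast
      ultimately show ?thesis
        using pqt b_e V_mono[of p q] by auto
    qed
  qed
  moreover have "small TYPE('u) (\<Union>p\<in>P. carrier (B p))"
  proof (rule small_subset)
    show "small TYPE('u) (g ` ?V)"
      by (rule small_image[OF small_V])
    show "(\<Union>p\<in>P. carrier (B p)) \<subseteq> g ` ?V"
    proof (rule UN_least)
      fix p assume p: "p \<in> P"
      have "e p ` V p \<subseteq> g ` V p" by (rule e(2)[OF p])
      also have "\<dots> \<subseteq> g ` ?V" by (rule image_mono[OF V_subset[OF p]])
      finally show "carrier (B p) \<subseteq> g ` ?V" using p by (simp only: carrier_B)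
    qed
  qed
  moreover have "small TYPE('u) (\<Union>p\<in>P. lang (B p))"
  proof (rule small_subset)
    show "small TYPE('u) (code ` ?O)"
      by (rule small_image[OF small_O])
    show "(\<Union>p\<in>P. lang (B p)) \<subseteq> code ` ?O"
    proof (rule UN_least)
      fix p assume p: "p \<in> P"
      show "lang (B p) \<subseteq> code ` ?O"
        using operations_subset[OF p] coded_colouring.algebra_fields(2)[OF coded[OF p]]
        by (auto simp: B_def)
    qed
  qed
  moreover have "naturally_isomorphic P r (\<lambda>p. Con_c (B p)) (\<lambda>p q. Con_c_map (B q) (b p q)) S s"
    unfolding naturally_isomorphic_def
  proof (intro exI[of _ \<eta>] conjI ballI)
    show "join_0_iso (Con_c (B p)) (S p) (\<eta> p)" if "p \<in> P" for p
      unfolding B_def \<eta>_def by (rule coded_colouring.Con_c_iso[OF coded[OF that]])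
    fix x assume "x \<in> r"
    then obtain p q where x: "x = (p, q)" and pq: "(p, q) \<in> r" by (cases x) auto
    interpret colouring_hom "S p" "C p" "col p" "e p" code decode "S q" "C q" "col q" "e q" "s p q"
      by (rule hom[OF pq])
    have "\<eta> q (Con_c_map (B q) (b p q) \<alpha>) = s p q (\<eta> p \<alpha>)"
      if \<alpha>: "\<alpha> \<in> carrier (Con_c (B p))" for \<alpha>
    proof -
      obtain a where a: "a \<in> carrier (S p)" "\<alpha> = L.con (L.down a)"
        using \<alpha> unfolding B_def L.carrier_Con_c by blast
      have "\<eta> p (L.con (L.down a)) = a"
        unfolding \<eta>_def by (rule inv_into_f_f[OF bij_betw_imp_inj_on[OF L.bij_con_down] a(1)])
      moreover have "\<eta> q (M.con (M.down (s p q a))) = s p q a"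
        unfolding \<eta>_def
        by (rule inv_into_f_f[OF bij_betw_imp_inj_on[OF M.bij_con_down] h_closed[OF a(1)]])
      ultimately show ?thesis
        using Con_c_map_transition[OF a(1)] unfolding a(2) B_def b_def by (simp only:)
    qed
    then show "case x of (p, q) \<Rightarrow> \<forall>\<alpha>\<in>carrier (Con_c (B p)).
        \<eta> q (Con_c_map (B q) (b p q) \<alpha>) = s p q (\<eta> p \<alpha>)"
      by (simp add: x)
  qed
  ultimately show ?thesis by blast
qed

end
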